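(* For all $n\ge0$, $$\sum_{\sigma\in\mathfrak S_n}q^{\mathrm{aid}(\sigma)}t^{\mathrm{des}(\sigma)}=\sum_{\sigma\in\mathfrak S_n}q^{\mathrm{maj}(\sigma)}t^{\mathrm{exc}(\sigma)}.$$
   Context: For $\sigma=\sigma_1\cdots\sigma_n\in\mathfrak S_n$: $\mathrm{Des}(\sigma)=\{i\in[n-1]:\sigma_i>\sigma_{i+1}\}$, $\mathrm{des}(\sigma)=|\mathrm{Des}(\sigma)|$, $\mathrm{maj}(\sigma)=\sum_{i\in\mathrm{Des}(\sigma)}i$, $\mathrm{exc}(\sigma)=|\{i:\sigma_i>i\}|$. An inversion of $\sigma$ is a pair $(\sigma_i,\sigma_j)$ with $i<j$, $\sigma_i>\sigma_j$; it is admissible if either ($i>1$ and $\sigma_{i-1}<\sigma_i$) or there is $k$ with $i<k<j$ and $\sigma_i<\sigma_k$. $\mathrm{ai}(\sigma)$ is the number of admissible inversions and $\mathrm{aid}(\sigma)=\mathrm{ai}(\sigma)+\mathrm{des}(\sigma)$. *)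

theory Defs
  imports Main
begin

text \<open>Permutations of [n] are represented as lists s = [s_1,...,s_n] (one-line notation),
  with positions 1-indexed: s_i = s ! (i - 1).\<close>

definition perms :: "nat \<Rightarrow> nat list set" where
  "perms n = {s. distinct s \<and> set s = {1..n}}"

abbreviation ent :: "nat list \<Rightarrow> nat \<Rightarrow> nat" where
  "ent s i \<equiv> s ! (i - 1)"

definition Des :: "nat list \<Rightarrow> nat set" where
  "Des s = {i \<in> {1..<length s}. ent s i > ent s (i + 1)}"

definition des :: "nat list \<Rightarrow> nat" where
  "des s = card (Des s)"

definition maj :: "nat list \<Rightarrow> nat" where
  "maj s = (\<Sum>i\<in>Des s. i)"

definition exc :: "nat list \<Rightarrow> nat" where
  "exc s = card {i \<in> {1..length s}. ent s i > i}"

text \<open>An inversion is identified by its pair of positions (i,j), i<j, s_i > s_j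
  (values are distinct so this is the same as counting value pairs).\<close>
definition admissible_inv :: "nat list \<Rightarrow> nat \<Rightarrow> nat \<Rightarrow> bool" where
  "admissible_inv s i j \<longleftrightarrow>
     1 \<le> i \<and> i < j \<and> j \<le> length s \<and> ent s i > ent s j \<and>
     ((i > 1 \<and> ent s (i - 1) < ent s i) \<or> (\<exists>k. i < k \<and> k < j \<and> ent s i < ent s k))"

definition ai :: "nat list \<Rightarrow> nat" where
  "ai s = card {(i, j). admissible_inv s i j}"

definition aid :: "nat list \<Rightarrow> nat" where
  "aid s = ai s + des s"

end

theory Submission
  imports
    Defs
    "HOL-Computational_Algebra.Polynomial"
    "HOL-Combinatorics.Permutations"
    "HOL-Combinatorics.Multiset_Permutations"
begin

text \<open>
  Put \<open>T = q t\<close>, let \<open>e\<close> be the \<open>q\<close>-exponential series and \<open>A\<close>, \<open>D\<close> the \<open>q\<close>-exponential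
  generating functions of \<open>\<Sum> q ^ maj * t ^ exc\<close> over all permutations and over derangements.
  Deleting fixed points shows that weighting each fixed point by \<open>r\<close> gives \<open>D(z) e(r z)\<close>; in
  particular \<open>A = D e\<close>. Composing permutations with an \<open>n\<close>-cycle exchanges excedances and weak
  excedances up to one and almost preserves \<open>maj\<close>; this amounts to \<open>D(z) e(T z) = T A(z) + 1 - T\<close>.
  Hence \<open>A = (1 - T) e(z) / (e(T z) - T e(z))\<close>, whose \<open>q\<close>-derivative is
  \<open>A(z) + T (A(z) - 1) A(q z)\<close>. Removing the maximum from a permutation gives the same recursion
  for \<open>\<Sum> q ^ aid * t ^ des\<close>.\<close>

section \<open>q-binomial coefficients and q-binomial convolution\<close>

text \<open>Removing the maximum suits \<open>aid\<close> and \<open>des\<close> but has no evident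
  counterpart for \<open>maj\<close> and \<open>exc\<close>; there the quadratic recursion is
  reached only by solving two linear relations for \<open>A\<close> and \<open>D\<close> and
  differentiating the quotient. The first relation holds because a fixed point compares with its
  neighbours like a letter between all excedances and all other letters. As far as descents go, a
  permutation is thus a shuffle of a derangement with a constant word, and the major index over such
  shuffles is governed by a q-binomial coefficient. In the second relation, counting weak excedances
  alone would give \<open>D(z) e(t z)\<close>. The failure of \<open>maj\<close> to drop by one when
  the last letter is fixed supplies exactly the missing powers of \<open>q\<close>, which is why
  \<open>T = q t\<close> appears. The summand \<open>1 - T\<close> corrects degree 0, where there is
  no cycle to compose with. Series are handled through their coefficient sequences, since
  q-factorials need not be invertible in the coefficient ring.\<close>

fun qbinom :: "'a::comm_ring_1 \<Rightarrow> nat \<Rightarrow> nat \<Rightarrow> 'a" where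
  "qbinom q n 0 = 1"
| "qbinom q 0 (Suc k) = 0"
| "qbinom q (Suc n) (Suc k) = qbinom q n k + q ^ Suc k * qbinom q n (Suc k)"

lemma qbinom_eq_0: "n < k \<Longrightarrow> qbinom q n k = 0"
proof (induction n arbitrary: k)
  case 0
  then show ?case by (cases k) auto
next
  case (Suc n)
  then show ?case by (cases k) auto
qed

lemma qbinom_self [simp]: "qbinom q n n = 1"
  by (induction n) (auto simp: qbinom_eq_0)

text \<open>The Pascal rule with the power of \<open>q\<close> on the other term. Comparing it with
  the defining recursion yields symmetry and absorption, and the shuffle count below needs both
  forms.\<close>

lemma qbinom_Suc_Suc':
  "k \<le> n \<Longrightarrow> qbinom q (Suc n) (Suc k) = q ^ (n - k) * qbinom q n k + qbinom q n (Suc k)"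
proof (induction n arbitrary: k)
  case 0
  then show ?case by simp
next
  case (Suc n)
  show ?case
  proof (cases k)
    case 0
    then show ?thesis using Suc.IH[of 0] by (simp add: algebra_simps)
  next
    case k: (Suc j)
    show ?thesis
    proof (cases "j = n")
      case True
      then show ?thesis using k by (simp add: qbinom_eq_0)
    next
      case False
      with Suc.prems k have j: "Suc j \<le> n" by simp
      obtain d where d: "n = Suc j + d"
        using j le_Suc_ex by blast
      have 1: "qbinom q (Suc n) (Suc j) = q ^ (n - j) * qbinom q n j + qbinom q n (Suc j)"
        using Suc.IH[of j] j by simp
      have 2: "qbinom q (Suc n) (Suc (Suc j))
          = q ^ (n - Suc j) * qbinom q n (Suc j) + qbinom q n (Suc (Suc j))"
        using Suc.IH[of "Suc j"] j by simp
      have "qbinom q (Suc (Suc n)) (Suc k)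
          = qbinom q (Suc n) (Suc j) + q ^ (Suc (Suc j)) * qbinom q (Suc n) (Suc (Suc j))"
        by (simp only: k qbinom.simps)
      also have "\<dots> = q ^ (n - j) * (qbinom q n j + q ^ Suc j * qbinom q n (Suc j))
          + (qbinom q n (Suc j) + q ^ Suc (Suc j) * qbinom q n (Suc (Suc j)))"
        unfolding 1 2 by (simp add: d algebra_simps power_add)
      also have "\<dots> = q ^ (Suc n - k) * qbinom q (Suc n) k + qbinom q (Suc n) (Suc k)"
        by (simp add: k)
      finally show ?thesis .
    qed
  qed
qed

lemma qbinom_symmetric: "k \<le> n \<Longrightarrow> qbinom q n (n - k) = qbinom q n k"
proof (induction n arbitrary: k)
  case 0
  then show ?case by simp
next
  case (Suc n)
  show ?case
  proof (cases k)
    case 0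
    then show ?thesis by (simp add: qbinom_eq_0 del: qbinom.simps(3))
  next
    case k: (Suc j)
    show ?thesis
    proof (cases "j = n")
      case True
      then show ?thesis using k by (simp del: qbinom.simps(3))
    next
      case False
      with Suc.prems k have j: "Suc j \<le> n" by simp
      then have e: "Suc n - k = Suc (n - k)" "n - j = Suc (n - k)" using k by auto
      have "qbinom q (Suc n) (Suc n - k) = qbinom q n (n - k) + q ^ Suc (n - k) * qbinom q n (n - j)"
        unfolding e by simp
      also have "\<dots> = qbinom q n k + q ^ (n - j) * qbinom q n j"
        using Suc.IH[of k] Suc.IH[of j] j k e by (metis Suc_leD)
      also have "\<dots> = qbinom q (Suc n) k"
        using qbinom_Suc_Suc'[of j n q] j k by (simp del: qbinom.simps(3) add: add.commute)
      finally show ?thesis .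
    qed
  qed
qed

text \<open>Equating the two Pascal rules relates the two smaller coefficients to each other. This
  is \<open>[n+1] binom(n,k) = [n+1-k] binom(n+1,k)\<close> for q-integers, with the denominators
  \<open>q - 1\<close> cleared.\<close>

lemma qbinom_absorb:
  assumes "k \<le> n"
  shows "(q ^ Suc n - 1) * qbinom q n k = (q ^ (Suc n - k) - 1) * qbinom q (Suc n) k"
proof (cases k)
  case 0
  then show ?thesis by simp
next
  case (Suc j)
  obtain d where d: "n = Suc j + d"
    using assms Suc le_Suc_ex by blast
  have "qbinom q n j + q ^ Suc j * qbinom q n (Suc j) = q ^ (n - j) * qbinom q n j + qbinom q n (Suc j)"
    using qbinom_Suc_Suc'[of j n q] d by simp
  then have 1: "(q ^ Suc d - 1) * qbinom q n j = (q ^ Suc j - 1) * qbinom q n (Suc j)"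
    by (simp add: d algebra_simps)
  have "(q ^ (Suc n - k) - 1) * qbinom q (Suc n) k
      = (q ^ Suc d - 1) * qbinom q n j + (q ^ Suc d - 1) * q ^ Suc j * qbinom q n (Suc j)"
    by (simp add: Suc d algebra_simps)
  also have "\<dots> = (q ^ Suc n - 1) * qbinom q n k"
    unfolding 1 by (simp add: Suc d algebra_simps power_add)
  finally show ?thesis by simp
qed

text \<open>The product of series \<open>\<Sum> f n z^n / [n]_q!\<close>, written on coefficients.
  The shift \<open>\<lambda>k. f (Suc k)\<close> is then the q-derivative, and
  \<open>\<lambda>k. q ^ k * f k\<close> is substitution of \<open>q z\<close> for
  \<open>z\<close>.\<close>

definition qconv :: "'a::comm_ring_1 \<Rightarrow> (nat \<Rightarrow> 'a) \<Rightarrow> (nat \<Rightarrow> 'a) \<Rightarrow> nat \<Rightarrow> 'a" where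
  "qconv q f g n = (\<Sum>k\<le>n. qbinom q n k * f k * g (n - k))"

lemma qconv_0 [simp]: "qconv q f g 0 = f 0 * g 0"
  by (simp add: qconv_def)

text \<open>The q-Leibniz rule \<open>(F G)' = F' G + F(q z) G'\<close>, obtained by splitting
  \<open>qbinom\<close> with its defining recursion.\<close>

lemma qconv_Suc:
  "qconv q f g (Suc n) =
     qconv q (\<lambda>k. f (Suc k)) g n + qconv q (\<lambda>k. q ^ k * f k) (\<lambda>k. g (Suc k)) n"
proof -
  define h where "h k = q ^ k * qbinom q n k * f k * g (Suc n - k)" for k
  have "qconv q f g (Suc n) = f 0 * g (Suc n) +
     (\<Sum>k\<le>n. qbinom q (Suc n) (Suc k) * f (Suc k) * g (n - k))"
    unfolding qconv_def by (subst sum.atMost_Suc_shift) simp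
  also have "(\<Sum>k\<le>n. qbinom q (Suc n) (Suc k) * f (Suc k) * g (n - k))
      = qconv q (\<lambda>k. f (Suc k)) g n + (\<Sum>k\<le>n. h (Suc k))"
    by (simp add: qconv_def h_def algebra_simps sum.distrib)
  finally have "qconv q f g (Suc n) = qconv q (\<lambda>k. f (Suc k)) g n + (h 0 + (\<Sum>k\<le>n. h (Suc k)))"
    by (simp add: h_def)
  also have "h 0 + (\<Sum>k\<le>n. h (Suc k)) = (\<Sum>k\<le>n. h k)"
    by (subst sum.atMost_Suc_shift[symmetric]) (simp add: h_def qbinom_eq_0)
  also have "\<dots> = qconv q (\<lambda>k. q ^ k * f k) (\<lambda>k. g (Suc k)) n"
    unfolding qconv_def h_def by (rule sum.cong) (auto simp: Suc_diff_le algebra_simps)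
  finally show ?thesis .
qed

lemma qconv_commute: "qconv q f g = qconv q g f"
proof
  fix n
  have "qconv q f g n = (\<Sum>k\<le>n. qbinom q n (n - k) * f (n - k) * g (n - (n - k)))"
    unfolding qconv_def
    by (rule sum.reindex_bij_witness[of _ "\<lambda>k. n - k" "\<lambda>k. n - k"]) auto
  also have "\<dots> = qconv q g f n"
    unfolding qconv_def by (rule sum.cong) (auto simp: qbinom_symmetric mult_ac)
  finally show "qconv q f g n = qconv q g f n" .
qed

lemma qconv_add_left: "qconv q (\<lambda>k. f k + g k) h n = qconv q f h n + qconv q g h n"
  and qconv_add_right: "qconv q f (\<lambda>k. g k + h k) n = qconv q f g n + qconv q f h n"
  and qconv_diff_right: "qconv q f (\<lambda>k. g k - h k) n = qconv q f g n - qconv q f h n"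
  and qconv_scale_left: "qconv q (\<lambda>k. c * f k) h n = c * qconv q f h n"
  and qconv_scale_right: "qconv q f (\<lambda>k. c * g k) n = c * qconv q f g n"
  by (simp_all add: qconv_def algebra_simps sum.distrib sum_distrib_left sum_subtractf)

text \<open>Substituting \<open>q z\<close> for \<open>z\<close> respects products.\<close>

lemma power_qconv: "q ^ n * qconv q f g n = qconv q (\<lambda>k. q ^ k * f k) (\<lambda>k. q ^ k * g k) n"
  unfolding qconv_def sum_distrib_left
proof (rule sum.cong)
  fix k assume "k \<in> {..n}"
  then have "q ^ n = q ^ k * q ^ (n - k)"
    by (simp flip: power_add)
  then show "q ^ n * (qbinom q n k * f k * g (n - k))
      = qbinom q n k * (q ^ k * f k) * (q ^ (n - k) * g (n - k))"
    by (simp add: mult_ac)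
qed simp

text \<open>By the Leibniz rule the q-derivatives of both sides expand into the same three triple
  products, so an induction over all \<open>f\<close>, \<open>g\<close>, \<open>h\<close> replaces
  any identity between products of q-binomial coefficients.\<close>

lemma qconv_assoc: "qconv q (qconv q f g) h n = qconv q f (qconv q g h) n"
proof (induction n arbitrary: f g h)
  case 0
  then show ?case by (simp add: mult_ac)
next
  case (Suc n)
  show ?case
    by (simp add: qconv_Suc[of _ _ _ n] qconv_Suc[of q f g] qconv_Suc[of q g h] qconv_add_left
      qconv_add_right power_qconv Suc.IH add.assoc)
qed

abbreviation qunit :: "nat \<Rightarrow> 'a::comm_ring_1" where
  "qunit k \<equiv> (if k = 0 then 1 else 0)"

lemma qconv_unit_left [simp]: "qconv q qunit f n = f n"
proof -
  have "qconv q qunit f n = (\<Sum>k\<le>n. if k = 0 then f n else 0)"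
    unfolding qconv_def by (rule sum.cong) auto
  then show ?thesis by simp
qed

lemma qconv_unit_right [simp]: "qconv q f qunit n = f n"
  using qconv_commute[of q f qunit] by (metis qconv_unit_left)

text \<open>If \<open>A(z)\<close>, \<open>D(z)\<close> are the \<open>q\<close>-exponential generating functions, the hypotheses say
  \<open>A = D e(z)\<close> and \<open>D (e(T z) - T e(z)) = 1 - T\<close>; the conclusion is the
  \<open>q\<close>-differential equation satisfied by \<open>A = (1 - T) e(z) / (e(T z) - T e(z))\<close>.\<close>

lemma qexp_quotient_Suc:
  fixes q T :: "'a::idom"
  assumes T: "T \<noteq> 1" and D0: "D 0 = 1"
    and A: "\<And>n. A n = qconv q D (\<lambda>_. 1) n"
    and TA: "\<And>n. 0 < n \<Longrightarrow> qconv q D (\<lambda>k. T ^ k) n = T * A n"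
  shows "A (Suc n) = A n + T * qconv q (\<lambda>k. A k - qunit k) (\<lambda>k. q ^ k * A k) n"
proof -
  let ?e = "\<lambda>_::nat. 1::'a"
  define E where "E k = T ^ k - T" for k
  have A_fun: "A = qconv q D ?e" using A by auto
  have DT: "qconv q D (\<lambda>k. T ^ k) n = T * A n + (1 - T) * qunit n" for n
    using TA[of n] D0 A[of 0] by (cases n) auto
  have DE: "qconv q D E = (\<lambda>n. (1 - T) * qunit n)"
  proof
    fix n
    have "qconv q D E n = qconv q D (\<lambda>k. T ^ k) n - T * qconv q D ?e n"
      unfolding E_def by (simp add: qconv_diff_right flip: qconv_scale_right)
    then show "qconv q D E n = (1 - T) * qunit n" by (simp add: DT flip: A)
  qed
  have ED: "qconv q E D = (\<lambda>n. (1 - T) * qunit n)"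
    using DE qconv_commute by metis
  have unit: "qconv q f (\<lambda>n. (1 - T) * qunit n) n = (1 - T) * f n" for f n
    by (simp only: qconv_scale_right qconv_unit_right)
  \<comment> \<open>\<open>A E = e D E = (1 - T) e\<close>.\<close>
  have AE: "qconv q A E n = (1 - T)" for n
  proof -
    have "qconv q A E n = qconv q ?e (qconv q D E) n"
      unfolding A_fun qconv_commute[of q D ?e] by (rule qconv_assoc)
    then show ?thesis by (simp only: DE unit mult_1_right)
  qed
  have A1: "qconv q D (\<lambda>k. 1 - T ^ k) k = (1 - T) * (A k - qunit k)" for k
    unfolding qconv_diff_right DT A[symmetric] by (simp add: algebra_simps)
  \<comment> \<open>q-differentiate \<open>A E = (1 - T) e\<close>: the series \<open>e\<close> is
    its own derivative, while \<open>E' = - T (e(z) - e(T z))\<close>.\<close>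
  have step: "qconv q (\<lambda>k. A (Suc k)) E n = (1 - T) + T * qconv q (\<lambda>k. q ^ k * A k) (\<lambda>k. 1 - T ^ k) n" for n
  proof -
    have "(1 - T) = qconv q (\<lambda>k. A (Suc k)) E n + qconv q (\<lambda>k. q ^ k * A k) (\<lambda>k. E (Suc k)) n"
      using qconv_Suc[of q A E n] AE by metis
    moreover have "(\<lambda>k. E (Suc k)) = (\<lambda>k. (- T) * (1 - T ^ k))"
      by (auto simp: E_def algebra_simps)
    ultimately have "1 - T = qconv q (\<lambda>k. A (Suc k)) E n
        + (- T) * qconv q (\<lambda>k. q ^ k * A k) (\<lambda>k. 1 - T ^ k) n"
      by (simp only: qconv_scale_right)
    then show ?thesis
      by (simp only: mult_minus_left add_uminus_conv_diff diff_add_cancel)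
  qed
  \<comment> \<open>Since \<open>E D = 1 - T\<close>, multiplying by \<open>D\<close> inverts
    \<open>E\<close> up to the factor \<open>1 - T\<close>, which is cancelled at the end because
    \<open>T \<noteq> 1\<close> in an integral domain.\<close>
  have "(1 - T) * A (Suc n) = qconv q (qconv q (\<lambda>k. A (Suc k)) E) D n"
    using qconv_assoc[of q "\<lambda>k. A (Suc k)" E D n] by (simp only: ED unit)
  also have "\<dots> = qconv q (\<lambda>n. (1 - T) * 1 + T * qconv q (\<lambda>k. q ^ k * A k) (\<lambda>k. 1 - T ^ k) n) D n"
    using step by (metis mult.right_neutral)
  also have "\<dots> = (1 - T) * A n + T * qconv q (qconv q (\<lambda>k. q ^ k * A k) (\<lambda>k. 1 - T ^ k)) D n"
    by (simp only: qconv_add_left qconv_scale_left qconv_commute[of q ?e D] A[symmetric])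
  also have "qconv q (qconv q (\<lambda>k. q ^ k * A k) (\<lambda>k. 1 - T ^ k)) D n
      = (1 - T) * qconv q (\<lambda>k. A k - qunit k) (\<lambda>k. q ^ k * A k) n"
  proof -
    have "qconv q (\<lambda>k. 1 - T ^ k) D = (\<lambda>k. (1 - T) * (A k - qunit k))"
      by (subst qconv_commute) (rule ext, rule A1)
    then show ?thesis
      by (simp only: qconv_assoc qconv_scale_right
        qconv_commute[of q "\<lambda>k. q ^ k * A k" "\<lambda>k. A k - qunit k"])
  qed
  finally have "(1 - T) * A (Suc n)
      = (1 - T) * (A n + T * qconv q (\<lambda>k. A k - qunit k) (\<lambda>k. q ^ k * A k) n)"
    by (simp add: algebra_simps)
  then show ?thesis using T by simp
qed

section \<open>The major index of shuffles with a constant word\<close>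

text \<open>The target is an arbitrary linear order so that the same notion covers permutations and
  the integer keys that replace them below.\<close>

definition fmaj :: "(nat \<Rightarrow> 'a::linorder) \<Rightarrow> nat \<Rightarrow> nat" where
  "fmaj f n = (\<Sum>i | i \<in> {1..<n} \<and> f i > f (Suc i). i)"

lemma fmaj_0 [simp]: "fmaj f 0 = 0" and fmaj_1 [simp]: "fmaj f (Suc 0) = 0"
  by (simp_all add: fmaj_def)

lemma fmaj_Suc: "fmaj f (Suc n) = fmaj f n + (if f n > f (Suc n) then n else 0)"
proof (cases "n = 0")
  case True
  then show ?thesis by simp
next
  case False
  then have "{i. i \<in> {1..<Suc n} \<and> f i > f (Suc i)}
      = {i. i \<in> {1..<n} \<and> f i > f (Suc i)} \<union> (if f n > f (Suc n) then {n} else {})"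
    by (auto simp: less_Suc_eq)
  then show ?thesis by (simp add: fmaj_def)
qed

lemma fmaj_cong:
  "(\<And>i. 1 \<le> i \<Longrightarrow> i < n \<Longrightarrow> f i > f (Suc i) \<longleftrightarrow> g i > g (Suc i)) \<Longrightarrow> fmaj f n = fmaj g n"
  unfolding fmaj_def by (rule arg_cong[of _ _ "sum id", unfolded id_def]) auto

text \<open>The shuffle of the word \<open>w 1, w 2, \<dots>\<close> with a constant word of zeros placed at the positions in \<open>F\<close>.\<close>

definition shuffle_key :: "(nat \<Rightarrow> int) \<Rightarrow> nat set \<Rightarrow> nat \<Rightarrow> int" where
  "shuffle_key w F i = (if i \<in> F then 0 else w (card ({1..i} - F)))"

definition subsets_of_card :: "nat \<Rightarrow> nat \<Rightarrow> nat set set" where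
  "subsets_of_card n m = {F. F \<subseteq> {1..n} \<and> card F = m}"

lemma finite_subsets_of_card [simp]: "finite (subsets_of_card n m)"
  by (rule finite_subset[of _ "Pow {1..n}"]) (auto simp: subsets_of_card_def)

text \<open>The flag \<open>b\<close> records whether the last letter is a zero: this decides which
  descents arise when another letter is appended.\<close>

definition shuffle_sum :: "bool \<Rightarrow> 'a::comm_ring_1 \<Rightarrow> (nat \<Rightarrow> int) \<Rightarrow> nat \<Rightarrow> nat \<Rightarrow> 'a" where
  "shuffle_sum b q w n m =
     (\<Sum>F | F \<in> subsets_of_card n m \<and> (n \<in> F \<longleftrightarrow> b). q ^ fmaj (shuffle_key w F) n)"

lemma shuffle_sum_split:
  "(\<Sum>F\<in>subsets_of_card n m. q ^ fmaj (shuffle_key w F) n)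
     = shuffle_sum True q w n m + shuffle_sum False q w n m"
proof -
  have "subsets_of_card n m = {F. F \<in> subsets_of_card n m \<and> (n \<in> F \<longleftrightarrow> True)}
      \<union> {F. F \<in> subsets_of_card n m \<and> (n \<in> F \<longleftrightarrow> False)}" by auto
  then show ?thesis
    unfolding shuffle_sum_def by (subst sum.union_disjoint[symmetric]) auto
qed

lemma card_Diff_subsets_of_card:
  assumes "F \<in> subsets_of_card n m" shows "card ({1..n} - F) = n - m"
  using assms by (auto simp: subsets_of_card_def card_Diff_subset finite_subset)

text \<open>A zero appended to a zero makes no descent; appended to a letter of \<open>w\<close> it
  makes one exactly if that letter is positive. The letter in question is \<open>w (n - m)\<close>,
  since \<open>n - m\<close> positions lie outside \<open>F\<close>.\<close>

lemma shuffle_sum_True_rec: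
  assumes "0 < n"
  shows "shuffle_sum True q w (Suc n) (Suc m) =
    shuffle_sum True q w n m + (if w (n - m) > 0 then q ^ n else 1) * shuffle_sum False q w n m"
proof -
  have key: "shuffle_key w (insert (Suc n) F) i = shuffle_key w F i" if "i \<le> n" for F i
  proof -
    have "{1..i} - insert (Suc n) F = {1..i} - F" using that by auto
    then show ?thesis using that by (simp add: shuffle_key_def)
  qed
  have fmaj: "fmaj (shuffle_key w (insert (Suc n) F)) (Suc n)
      = fmaj (shuffle_key w F) n + (if n \<notin> F \<and> w (n - m) > 0 then n else 0)"
    if F: "F \<in> subsets_of_card n m" for F
  proof -
    have "fmaj (shuffle_key w (insert (Suc n) F)) n = fmaj (shuffle_key w F) n"
      by (rule fmaj_cong) (simp add: key)
    then show ?thesis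
      using card_Diff_subsets_of_card[OF F] key[of n F]
      by (simp add: fmaj_Suc) (simp add: shuffle_key_def)
  qed
  have "shuffle_sum True q w (Suc n) (Suc m)
      = (\<Sum>F\<in>subsets_of_card n m. q ^ fmaj (shuffle_key w (insert (Suc n) F)) (Suc n))"
    unfolding shuffle_sum_def
  proof (rule sum.reindex_bij_witness[of _ "insert (Suc n)" "\<lambda>F. F - {Suc n}"], goal_cases)
    case (2 F)
    then show ?case
      by (auto simp: subsets_of_card_def atLeastAtMostSuc_conv)
  next
    case (4 F)
    then have "F \<subseteq> {1..n}" by (simp add: subsets_of_card_def)
    then have "Suc n \<notin> F" "finite F" by (auto simp: finite_subset)
    with 4 show ?case by (auto simp: subsets_of_card_def)
  qed (auto simp: subsets_of_card_def insert_absorb)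
  also have "\<dots> = (\<Sum>F\<in>subsets_of_card n m.
      q ^ fmaj (shuffle_key w F) n * (if n \<notin> F \<and> w (n - m) > 0 then q ^ n else 1))"
    by (rule sum.cong) (auto simp: fmaj power_add)
  also have "\<dots> = (\<Sum>F | F \<in> subsets_of_card n m \<and> n \<in> F.
        q ^ fmaj (shuffle_key w F) n * (if n \<notin> F \<and> w (n - m) > 0 then q ^ n else 1))
    + (\<Sum>F | F \<in> subsets_of_card n m \<and> n \<notin> F.
        q ^ fmaj (shuffle_key w F) n * (if n \<notin> F \<and> w (n - m) > 0 then q ^ n else 1))"
    by (subst sum.union_disjoint[symmetric]) (auto intro!: sum.cong)
  also have "\<dots> = shuffle_sum True q w n m
      + (if w (n - m) > 0 then q ^ n else 1) * shuffle_sum False q w n m"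
    unfolding shuffle_sum_def sum_distrib_left
    by (intro arg_cong2[of _ _ _ _ "(+)"] sum.cong) auto
  finally show ?thesis .
qed

lemma shuffle_sum_False_rec:
  assumes "0 < n" "m \<le> n"
  shows "shuffle_sum False q w (Suc n) m =
    (if w (Suc n - m) < 0 then q ^ n else 1) * shuffle_sum True q w n m
    + (if w (n - m) > w (Suc n - m) then q ^ n else 1) * shuffle_sum False q w n m"
proof -
  let ?c = "\<lambda>F. if (if n \<in> F then 0 else w (n - m)) > w (Suc n - m) then n else 0"
  have fmaj: "fmaj (shuffle_key w F) (Suc n) = fmaj (shuffle_key w F) n + ?c F"
    if F: "F \<in> subsets_of_card n m" for F
  proof -
    have "F \<in> subsets_of_card (Suc n) m" "Suc n \<notin> F"
      using F by (auto simp: subsets_of_card_def)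
    then show ?thesis
      using card_Diff_subsets_of_card[OF F] card_Diff_subsets_of_card[of F "Suc n" m]
      by (auto simp: fmaj_Suc shuffle_key_def)
  qed
  have "shuffle_sum False q w (Suc n) m
      = (\<Sum>F\<in>subsets_of_card n m. q ^ fmaj (shuffle_key w F) (Suc n))"
    unfolding shuffle_sum_def
    by (rule sum.cong) (auto simp: subsets_of_card_def atLeastAtMostSuc_conv)
  also have "\<dots> = (\<Sum>F\<in>subsets_of_card n m. q ^ fmaj (shuffle_key w F) n * q ^ ?c F)"
    by (rule sum.cong) (auto simp: fmaj power_add)
  also have "\<dots> = (\<Sum>F | F \<in> subsets_of_card n m \<and> n \<in> F. q ^ fmaj (shuffle_key w F) n * q ^ ?c F)
    + (\<Sum>F | F \<in> subsets_of_card n m \<and> n \<notin> F. q ^ fmaj (shuffle_key w F) n * q ^ ?c F)"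
    by (subst sum.union_disjoint[symmetric]) (auto intro!: sum.cong)
  also have "\<dots> = (if w (Suc n - m) < 0 then q ^ n else 1) * shuffle_sum True q w n m
    + (if w (n - m) > w (Suc n - m) then q ^ n else 1) * shuffle_sum False q w n m"
    unfolding shuffle_sum_def sum_distrib_left
    by (intro arg_cong2[of _ _ _ _ "(+)"] sum.cong) auto
  finally show ?thesis .
qed

lemma shuffle_sum_True_0: "shuffle_sum True q w n 0 = 0"
  unfolding shuffle_sum_def
  by (rule sum.neutral) (auto simp: subsets_of_card_def dest: finite_subset)

lemma shuffle_sum_False_self: "0 < n \<Longrightarrow> shuffle_sum False q w n n = 0"
proof -
  assume "0 < n"
  have "n \<in> F" if "F \<in> subsets_of_card n n" for F
  proof -
    have "F = {1..n}"
      using that by (intro card_subset_eq) (auto simp: subsets_of_card_def)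
    then show ?thesis using \<open>0 < n\<close> by simp
  qed
  then have "{F. F \<in> subsets_of_card n n \<and> (n \<in> F \<longleftrightarrow> False)} = {}" by auto
  then show ?thesis unfolding shuffle_sum_def by (simp only: sum.empty)
qed

text \<open>The total over both flags would not carry an induction, because the recursions mix the
  two classes; the refined closed forms do and have to be proved together.\<close>

lemma shuffle_sum_eq:
  assumes w: "\<And>i. w i \<noteq> 0"
    and "m \<le> n"
  shows "shuffle_sum False q w (Suc n) m =
      q ^ fmaj w (Suc n - m) * (if w (Suc n - m) < 0 then q ^ m else 1) * qbinom q n m
    \<and> shuffle_sum True q w (Suc n) (Suc m) =
      q ^ fmaj w (n - m) * (if w (n - m) > 0 then q ^ (n - m) else 1) * qbinom q n m"
    (is "?F n m \<and> ?T n m")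
  using \<open>m \<le> n\<close>
proof (induction n arbitrary: m)
  case 0
  have "{F. F \<in> subsets_of_card (Suc 0) 0 \<and> Suc 0 \<notin> F} = {{}}"
    "{F. F \<in> subsets_of_card (Suc 0) (Suc 0) \<and> Suc 0 \<in> F} = {{Suc 0}}"
    by (auto simp: subsets_of_card_def)
  then show ?case
    using 0 by (auto simp: shuffle_sum_def)
next
  case (Suc n)
  have IHF: "?F n m" and IHT: "?T n m" if "m \<le> n" for m
    using Suc.IH[OF that] by blast+
  have "?F (Suc n) m"
  proof (cases m)
    case 0
    show ?thesis
      using IHF[of 0] 0 fmaj_Suc[of w "Suc n"]
      by (simp add: shuffle_sum_False_rec shuffle_sum_True_0 power_add)
  next
    case m: (Suc j)
    show ?thesis
    proof (cases "j = n")
      case True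
      then show ?thesis
        using IHT[of n] m
        by (simp add: shuffle_sum_False_rec shuffle_sum_False_self)
    next
      case False
      with Suc.prems m have "Suc j \<le> n" by simp
      then obtain d where d: "n = Suc j + d"
        using le_Suc_ex by blast
      have F: "shuffle_sum False q w (Suc n) m =
        q ^ fmaj w (Suc d) * (if w (Suc d) < 0 then q ^ m else 1) * qbinom q n m"
        using IHF[of m] m d by simp
      have T: "shuffle_sum True q w (Suc n) m =
        q ^ fmaj w (Suc d) * (if w (Suc d) > 0 then q ^ (Suc d) else 1) * qbinom q n j"
        using IHT[of j] m d by simp
      have B: "qbinom q (Suc n) m = qbinom q n j + q ^ m * qbinom q n m"
        by (simp add: m)
      have B': "qbinom q (Suc n) m = q ^ Suc d * qbinom q n j + qbinom q n m"
        using qbinom_Suc_Suc'[of j n q] m d by simp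
      have M: "fmaj w (Suc (Suc d)) = fmaj w (Suc d) + (if w (Suc d) > w (Suc (Suc d)) then Suc d else 0)"
        by (rule fmaj_Suc)
      have e: "Suc (Suc n) - m = Suc (Suc d)" "Suc n - m = Suc d" using d m by auto
      have R: "shuffle_sum False q w (Suc (Suc n)) m =
        (if w (Suc (Suc d)) < 0 then q ^ (m + Suc d) else 1) * shuffle_sum True q w (Suc n) m
        + (if w (Suc d) > w (Suc (Suc d)) then q ^ (m + Suc d) else 1) * shuffle_sum False q w (Suc n) m"
        using shuffle_sum_False_rec[of "Suc n" m q w] e d m by (simp add: add.commute)
      \<comment> \<open>Descents next to a zero depend only on signs. In each case a common power of
        \<open>q\<close> factors out of the two summands of \<open>R\<close>, and what remains is
        the right-hand side of \<open>B\<close> or of \<open>B'\<close>.\<close>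
      consider "w (Suc d) > 0" "w (Suc (Suc d)) > 0" | "w (Suc d) > 0" "w (Suc (Suc d)) < 0"
        | "w (Suc d) < 0" "w (Suc (Suc d)) > 0" | "w (Suc d) < 0" "w (Suc (Suc d)) < 0"
        using w by (metis linorder_neqE_linordered_idom)
      then show ?thesis
      proof cases
        case 1
        show ?thesis
        proof (cases "w (Suc d) > w (Suc (Suc d))")
          case True
          with 1 show ?thesis unfolding R F T e(1) M B by (simp add: power_add algebra_simps)
        next
          case False
          with 1 show ?thesis unfolding R F T e(1) M B' by (simp add: power_add algebra_simps)
        qed
      next
        case 2
        then show ?thesis unfolding R F T e(1) M B' by (simp add: power_add algebra_simps)
      next
        case 3
        then show ?thesis unfolding R F T e(1) M B by (simp add: power_add algebra_simps)
      next
        case 4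
        show ?thesis
        proof (cases "w (Suc d) > w (Suc (Suc d))")
          case True
          with 4 show ?thesis unfolding R F T e(1) M B by (simp add: power_add algebra_simps)
        next
          case False
          with 4 show ?thesis unfolding R F T e(1) M B' by (simp add: power_add algebra_simps)
        qed
      qed
    qed
  qed
  moreover have "?T (Suc n) m"
  proof (cases m)
    case 0
    then show ?thesis
      using IHF[of 0] w[of "Suc n"]
      by (simp add: shuffle_sum_True_rec shuffle_sum_True_0)
  next
    case m: (Suc j)
    show ?thesis
    proof (cases "j = n")
      case True
      then show ?thesis
        using IHT[of n] m
        by (simp add: shuffle_sum_True_rec shuffle_sum_False_self)
    next
      case False
      with Suc.prems m have "Suc j \<le> n" by simp
      then obtain d where d: "n = Suc j + d"
        using le_Suc_ex by blast
      have F: "shuffle_sum False q w (Suc n) m =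
        q ^ fmaj w (Suc d) * (if w (Suc d) < 0 then q ^ m else 1) * qbinom q n m"
        using IHF[of m] m d by simp
      have T: "shuffle_sum True q w (Suc n) m =
        q ^ fmaj w (Suc d) * (if w (Suc d) > 0 then q ^ (Suc d) else 1) * qbinom q n j"
        using IHT[of j] m d by simp
      have B: "qbinom q (Suc n) m = qbinom q n j + q ^ m * qbinom q n m"
        by (simp add: m)
      have e: "Suc n - m = Suc d" "Suc n = m + Suc d" using d m by auto
      have R: "shuffle_sum True q w (Suc (Suc n)) (Suc m) =
        shuffle_sum True q w (Suc n) m
        + (if w (Suc d) > 0 then q ^ (m + Suc d) else 1) * shuffle_sum False q w (Suc n) m"
        using shuffle_sum_True_rec[of "Suc n" q w m] e by simp
      show ?thesis
        unfolding R F T e(1) B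
        using w[of "Suc d"] by (auto simp: power_add algebra_simps)
    qed
  qed
  ultimately show ?case ..
qed

text \<open>The shuffle theorem for the major index when one of the two words is constant: the zeros
  have no descents among themselves, and apart from \<open>fmaj w\<close> only the lengths
  enter.\<close>

lemma sum_shuffle_maj:
  assumes w: "\<And>i. w i \<noteq> 0" and m: "m \<le> n"
  shows "(\<Sum>F\<in>subsets_of_card n m. q ^ fmaj (shuffle_key w F) n) = q ^ fmaj w (n - m) * qbinom q n m"
proof (cases n)
  case 0
  have "subsets_of_card 0 0 = {{}}" by (auto simp: subsets_of_card_def)
  then show ?thesis using 0 m by simp
next
  case n: (Suc n')
  show ?thesis
  proof (cases m)
    case 0
    then show ?thesis using n w
      by (simp add: shuffle_sum_split shuffle_sum_True_0 shuffle_sum_eq)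
  next
    case m': (Suc j)
    show ?thesis
    proof (cases "j = n'")
      case True
      then show ?thesis using n w m'
        by (simp add: shuffle_sum_split shuffle_sum_False_self shuffle_sum_eq)
    next
      case False
      then have j: "Suc j \<le> n'" using n m' m by simp
      have 1: "qbinom q (Suc n') (Suc j) = q ^ (n' - j) * qbinom q n' j + qbinom q n' (Suc j)"
        using qbinom_Suc_Suc' j by (metis Suc_leD)
      have F: "shuffle_sum False q w (Suc n') (Suc j) =
        q ^ fmaj w (n' - j) * (if w (n' - j) < 0 then q ^ Suc j else 1) * qbinom q n' (Suc j)"
        using shuffle_sum_eq[of w "Suc j" n' q, OF w j] by simp
      have T: "shuffle_sum True q w (Suc n') (Suc j) =
        q ^ fmaj w (n' - j) * (if w (n' - j) > 0 then q ^ (n' - j) else 1) * qbinom q n' j"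
        using shuffle_sum_eq[of w j n' q, OF w] j by simp
      show ?thesis
      proof (cases "w (n' - j) > 0")
        case True
        then show ?thesis
          unfolding shuffle_sum_split n m' F T 1 by (simp add: algebra_simps)
      next
        case False
        then have "w (n' - j) < 0" using w[of "n' - j"] by linarith
        then show ?thesis
          unfolding shuffle_sum_split n m' F T by (simp add: algebra_simps)
      qed
    qed
  qed
qed

section \<open>Permutations with prescribed fixed points\<close>

definition fixpts :: "(nat \<Rightarrow> nat) \<Rightarrow> nat \<Rightarrow> nat set" where
  "fixpts p n = {i \<in> {1..n}. p i = i}"

definition fexc :: "(nat \<Rightarrow> nat) \<Rightarrow> nat \<Rightarrow> nat" where
  "fexc p n = card {i \<in> {1..n}. p i > i}"

definition derangements :: "nat \<Rightarrow> (nat \<Rightarrow> nat) set" where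
  "derangements n = {p. p permutes {1..n} \<and> fixpts p n = {}}"

definition derangement_sum :: "'a::comm_ring_1 \<Rightarrow> 'a \<Rightarrow> nat \<Rightarrow> 'a" where
  "derangement_sum q t n = (\<Sum>p\<in>derangements n. q ^ fmaj p n * t ^ fexc p n)"

text \<open>An excedance at a neighbour of a fixed point \<open>i\<close> always compares with \<open>i\<close> like a larger letter,
  and an anti-excedance like a smaller one. So fixed points may be replaced by zeros once the excedances
  are made positive and the other letters negative, and this does not change the descents of a derangement.\<close>

definition derangement_key :: "(nat \<Rightarrow> nat) \<Rightarrow> nat \<Rightarrow> nat \<Rightarrow> int" where
  "derangement_key p n i =
     (if p i > i then int (p i) else if i \<in> {1..n} then int (p i) - int n - 1 else -1)"

text \<open>Subtracting \<open>n + 1\<close> gives a negative number because \<open>p i\<close> is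
  at most \<open>n\<close>. The value -1 outside \<open>{1..n}\<close> keeps the key nonzero at
  every index, as \<open>sum_shuffle_maj\<close> demands.\<close>

lemma derangement_key_sign:
  assumes "p permutes {1..n}"
  shows "derangement_key p n i > 0 \<longleftrightarrow> p i > i" and "derangement_key p n i \<noteq> 0"
proof -
  have "p i \<le> n" if "i \<in> {1..n}"
    using permutes_in_image[OF assms, of i] that by simp
  then show "derangement_key p n i > 0 \<longleftrightarrow> p i > i" "derangement_key p n i \<noteq> 0"
    by (auto simp: derangement_key_def)
qed

text \<open>Only neighbours of opposite type need care. If \<open>i\<close> is an excedance and
  \<open>Suc i\<close> is not, then \<open>p i > i\<close> and \<open>p (Suc i) < Suc i\<close>
  force a descent; in the opposite case \<open>p i < i < p (Suc i)\<close>. The key orders both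
  pairs in the same way.\<close>

lemma derangement_key_less:
  assumes p: "p \<in> derangements n" and i: "i \<in> {1..<n}"
  shows "derangement_key p n i > derangement_key p n (Suc i) \<longleftrightarrow> p i > p (Suc i)"
proof -
  have perm: "p permutes {1..n}" and nf: "p i \<noteq> i" "p (Suc i) \<noteq> Suc i"
    using p i by (auto simp: derangements_def fixpts_def)
  have "p i \<in> {1..n}" "p (Suc i) \<in> {1..n}"
    using i permutes_in_image[OF perm] by simp_all
  then show ?thesis
    using nf i by (auto simp: derangement_key_def)
qed

lemma fmaj_derangement_key:
  "p \<in> derangements n \<Longrightarrow> fmaj (derangement_key p n) n = fmaj p n"
  by (rule fmaj_cong) (simp add: derangement_key_less)

locale fixed_set =
  fixes n m :: nat and F :: "nat set"
  assumes F: "F \<in> subsets_of_card n m"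
begin

definition rank :: "nat \<Rightarrow> nat" where
  "rank i = card ({1..i} - F)"

abbreviation "C \<equiv> {1..n} - F"

lemma rank_mono: "i \<le> j \<Longrightarrow> rank i \<le> rank j"
  unfolding rank_def by (rule card_mono) auto

lemma rank_less: "i < j \<Longrightarrow> j \<in> C \<Longrightarrow> rank i < rank j"
  unfolding rank_def
proof (rule psubset_card_mono)
  assume "i < j" "j \<in> C"
  then have "j \<in> {1..j} - F" "j \<notin> {1..i} - F" "{1..i} - F \<subseteq> {1..j} - F" by auto
  then show "{1..i} - F \<subset> {1..j} - F" by blast
qed simp

lemma rank_less_iff: "i \<in> C \<Longrightarrow> j \<in> C \<Longrightarrow> rank i < rank j \<longleftrightarrow> i < j"
  using rank_less[of i j] rank_less[of j i] by (metis linorder_less_linear order_less_asym)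

lemma card_C: "card C = n - m"
  using F by (rule card_Diff_subsets_of_card)

lemma bij_betw_rank: "bij_betw rank C {1..n - m}"
proof -
  have inj: "inj_on rank C"
    by (rule inj_onI) (metis rank_less_iff linorder_neq_iff)
  moreover have "rank ` C \<subseteq> {1..n - m}"
  proof
    fix y assume "y \<in> rank ` C"
    then obtain x where x: "x \<in> C" "y = rank x" by auto
    then have "rank 0 < rank x" by (intro rank_less) auto
    moreover have "rank x \<le> rank n" using x by (intro rank_mono) auto
    ultimately show "y \<in> {1..n - m}" using x card_C by (simp add: rank_def)
  qed
  moreover have "card (rank ` C) = card {1..n - m}"
    using card_image[OF inj] card_C by simp
  ultimately show ?thesis
    unfolding bij_betw_def by (metis card_subset_eq finite_atLeastAtMost)
qed

text \<open>Conjugation by \<open>rank\<close> on \<open>C\<close>, extended by the identity: the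
  inverse of deleting the fixed points \<open>F\<close> and standardising.\<close>

definition blow_up :: "(nat \<Rightarrow> nat) \<Rightarrow> nat \<Rightarrow> nat" where
  "blow_up \<tau> x = (if x \<in> C then inv_into C rank (\<tau> (rank x)) else x)"

lemma blow_up_C:
  assumes \<tau>: "\<tau> permutes {1..n - m}" and x: "x \<in> C"
  shows "blow_up \<tau> x \<in> C" and "rank (blow_up \<tau> x) = \<tau> (rank x)"
proof -
  have "rank x \<in> {1..n - m}" using bij_betw_rank x by (auto simp: bij_betw_def)
  then have "\<tau> (rank x) \<in> rank ` C"
    using permutes_in_image[OF \<tau>] bij_betw_rank by (simp add: bij_betw_def)
  then show "blow_up \<tau> x \<in> C" "rank (blow_up \<tau> x) = \<tau> (rank x)"
    using x inv_into_into[of "\<tau> (rank x)" rank C] f_inv_into_f[of "\<tau> (rank x)" rank C]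
    by (simp_all add: blow_up_def)
qed

lemma bij_betw_blow_up_permutes:
  "bij_betw blow_up {\<tau>. \<tau> permutes {1..n - m}} {p. p permutes C}"
proof -
  have "bij_betw (\<lambda>\<pi> x. if x \<in> C then inv_into C rank (\<pi> (inv_into {1..n - m} (inv_into C rank) x)) else x)
    {\<tau>. \<tau> permutes {1..n - m}} {p. p permutes C}"
    by (rule bij_betw_permutations) (rule bij_betw_inv_into[OF bij_betw_rank])
  also have "(\<lambda>\<pi> x. if x \<in> C then inv_into C rank (\<pi> (inv_into {1..n - m} (inv_into C rank) x)) else x) = blow_up"
    by (intro ext) (simp add: blow_up_def inv_into_inv_into_eq[OF bij_betw_rank] del: One_nat_def Diff_iff atLeastAtMost_iff)
  finally show ?thesis .
qed

lemma blow_up_eq_self_iff: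
  assumes "\<tau> permutes {1..n - m}" "x \<in> C"
  shows "blow_up \<tau> x = x \<longleftrightarrow> \<tau> (rank x) = rank x"
  using blow_up_C[OF assms] assms(2) rank_less_iff by (metis linorder_neq_iff)

lemma blow_up_derangement_iff:
  assumes \<tau>: "\<tau> permutes {1..n - m}"
  shows "fixpts \<tau> (n - m) = {} \<longleftrightarrow> fixpts (blow_up \<tau>) n = F"
proof -
  have "{1..n - m} = rank ` C" using bij_betw_rank by (simp add: bij_betw_def)
  then have "fixpts \<tau> (n - m) = {} \<longleftrightarrow> (\<forall>x\<in>C. blow_up \<tau> x \<noteq> x)"
    by (auto simp: fixpts_def blow_up_eq_self_iff[OF \<tau>])
  moreover have "F \<subseteq> {1..n}" using F by (auto simp: subsets_of_card_def)
  then have "fixpts (blow_up \<tau>) n = F \<union> {x \<in> C. blow_up \<tau> x = x}"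
    by (auto simp: fixpts_def blow_up_def)
  then have "fixpts (blow_up \<tau>) n = F \<longleftrightarrow> (\<forall>x\<in>C. blow_up \<tau> x \<noteq> x)"
    by blast
  ultimately show ?thesis by simp
qed

lemma permutes_fixpts:
  "p permutes {1..n} \<and> fixpts p n = F \<longleftrightarrow> p permutes C \<and> fixpts p n = F"
proof safe
  assume p: "p permutes {1..n}" "F = fixpts p n"
  then show "p permutes {1..n} - fixpts p n"
    by (intro permutes_superset[OF p(1)]) (auto simp: fixpts_def)
next
  assume "p permutes {1..n} - fixpts p n"
  then show "p permutes {1..n}" by (rule permutes_subset) auto
qed

lemma bij_betw_blow_up:
  "bij_betw blow_up (derangements (n - m)) {p. p permutes {1..n} \<and> fixpts p n = F}"
proof -
  have "derangements (n - m)
      = {\<tau> \<in> {\<tau>. \<tau> permutes {1..n - m}}. fixpts \<tau> (n - m) = {}}"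
    by (simp add: derangements_def)
  moreover have "{p. p permutes {1..n} \<and> fixpts p n = F}
      = {p \<in> {p. p permutes C}. fixpts p n = F}"
    using permutes_fixpts by blast
  ultimately show ?thesis
    using bij_betw_Collect[OF bij_betw_blow_up_permutes, of "\<lambda>p. fixpts p n = F"]
      blow_up_derangement_iff by simp
qed

lemma blow_up_greater_iff:
  assumes "\<tau> permutes {1..n - m}" "x \<in> C"
  shows "blow_up \<tau> x > x \<longleftrightarrow> \<tau> (rank x) > rank x"
  using blow_up_C[OF assms] assms(2) rank_less_iff by metis

lemma fexc_blow_up:
  assumes \<tau>: "\<tau> permutes {1..n - m}"
  shows "fexc (blow_up \<tau>) n = fexc \<tau> (n - m)"
proof -
  have img: "rank ` C = {1..n - m}" and inj: "inj_on rank C"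
    using bij_betw_rank by (auto simp: bij_betw_def)
  have "{i \<in> {1..n - m}. \<tau> i > i} = rank ` {x \<in> C. blow_up \<tau> x > x}"
    unfolding img[symmetric] by (auto simp: blow_up_greater_iff[OF \<tau>])
  moreover have "card (rank ` {x \<in> C. blow_up \<tau> x > x}) = card {x \<in> C. blow_up \<tau> x > x}"
    by (rule card_image, rule inj_on_subset[OF inj]) auto
  moreover have "{x \<in> C. blow_up \<tau> x > x} = {i \<in> {1..n}. blow_up \<tau> i > i}"
    by (auto simp: blow_up_def)
  ultimately show ?thesis by (simp add: fexc_def)
qed

lemma fmaj_blow_up:
  assumes "\<tau> \<in> derangements (n - m)"
  shows "fmaj (blow_up \<tau>) n = fmaj (shuffle_key (derangement_key \<tau> (n - m)) F) n"
proof (rule fmaj_cong)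
  fix i assume i: "1 \<le> i" "i < n"
  have \<tau>: "\<tau> permutes {1..n - m}" using assms by (simp add: derangements_def)
  let ?p = "blow_up \<tau>" and ?w = "derangement_key \<tau> (n - m)"
  let ?k = "shuffle_key ?w F"
  have "?p permutes C"
    using bij_betw_blow_up_permutes \<tau> by (auto simp: bij_betw_def)
  then have inj: "?p x = ?p y \<longleftrightarrow> x = y" for x y
    using permutes_inj by (metis inj_eq)
  have in_F: "?p x = x" "?k x = 0" if "x \<in> F" for x
    using that by (auto simp: blow_up_def shuffle_key_def)
  have key: "?k x = ?w (rank x)" if "x \<notin> F" for x
    using that by (simp add: shuffle_key_def rank_def)
  have sign: "?w (rank x) > 0 \<longleftrightarrow> ?p x > x" "?w (rank x) \<noteq> 0" "?p x \<noteq> x" if "x \<in> C" for x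
  proof -
    show "?w (rank x) > 0 \<longleftrightarrow> ?p x > x" "?w (rank x) \<noteq> 0"
      using derangement_key_sign[OF \<tau>] blow_up_greater_iff[OF \<tau> that] by auto
    have "rank x \<in> {1..n - m}" using bij_betw_rank that by (auto simp: bij_betw_def)
    then show "?p x \<noteq> x"
      using blow_up_eq_self_iff[OF \<tau> that] assms by (auto simp: derangements_def fixpts_def)
  qed
  consider "i \<in> F" "Suc i \<in> F" | "i \<in> F" "Suc i \<notin> F" | "i \<notin> F" "Suc i \<in> F" | "i \<notin> F" "Suc i \<notin> F"
    by blast
  then show "?p i > ?p (Suc i) \<longleftrightarrow> ?k i > ?k (Suc i)"
  proof cases
    case 1
    then show ?thesis by (simp add: in_F)
  next
    case 2
    \<comment> \<open>The value \<open>i\<close> is already taken at \<open>i\<close>, so a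
      non-excedance at \<open>Suc i\<close> lies strictly below \<open>i\<close>. Hence the sign
      alone decides the comparison; the next case is the mirror image.\<close>
    then have "?p (Suc i) \<noteq> i" using inj[of "Suc i" i] in_F by simp
    then show ?thesis using 2 i sign[of "Suc i"] by (auto simp: in_F key)
  next
    case 3
    then have "?p i \<noteq> Suc i" using inj[of i "Suc i"] in_F by simp
    then show ?thesis using 3 i sign[of i] by (auto simp: in_F key)
  next
    case 4
    then have iC: "i \<in> C" "Suc i \<in> C" using i by auto
    have "{1..Suc i} - F = insert (Suc i) ({1..i} - F)" using 4 by auto
    \<comment> \<open>Neighbours outside \<open>F\<close> have consecutive ranks, so they are
      neighbours in the derangement too.\<close>
    then have r: "rank (Suc i) = Suc (rank i)" by (simp add: rank_def)
    have "rank x \<in> {1..n - m}" if "x \<in> C" for x using bij_betw_rank that by (auto simp: bij_betw_def)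
    from this[OF iC(1)] this[OF iC(2)] have "rank i \<in> {1..<n - m}" using r by simp
    then have "?w (rank i) > ?w (rank (Suc i)) \<longleftrightarrow> \<tau> (rank i) > \<tau> (rank (Suc i))"
      unfolding r by (rule derangement_key_less[OF assms])
    also have "\<dots> \<longleftrightarrow> ?p i > ?p (Suc i)"
      using blow_up_C[OF \<tau> iC(1)] blow_up_C[OF \<tau> iC(2)] rank_less_iff by metis
    finally show ?thesis using 4 by (simp add: key)
  qed
qed

end

lemma finite_derangements [simp]: "finite (derangements n)"
  by (rule finite_subset[of _ "{p. p permutes {1..n}}"])
    (auto simp: derangements_def finite_permutations)

lemma sum_fixpts_eq:
  assumes "F \<in> subsets_of_card n m"
  shows "(\<Sum>p | p permutes {1..n} \<and> fixpts p n = F. q ^ fmaj p n * t ^ fexc p n)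
     = (\<Sum>\<tau>\<in>derangements (n - m).
          q ^ fmaj (shuffle_key (derangement_key \<tau> (n - m)) F) n * t ^ fexc \<tau> (n - m))"
proof -
  interpret fixed_set n m F by unfold_locales (rule assms)
  show ?thesis
    by (subst sum.reindex_bij_betw[OF bij_betw_blow_up, symmetric])
      (auto intro!: sum.cong simp: fmaj_blow_up fexc_blow_up derangements_def)
qed

text \<open>This is Wachs' theorem on \<open>q\<close>-derangement numbers, refined by excedances.\<close>

lemma sum_maj_exc_fix:
  "(\<Sum>p | p permutes {1..n}. q ^ fmaj p n * t ^ fexc p n * r ^ card (fixpts p n))
     = qconv q (\<lambda>k. r ^ k) (derangement_sum q t) n"
proof -
  let ?S = "{p. p permutes {1..n}}"
  let ?f = "\<lambda>p. q ^ fmaj p n * t ^ fexc p n"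
  have fin: "finite ?S" by (simp add: finite_permutations)
  have card_le: "card (fixpts p n) \<le> n" for p
  proof -
    have "fixpts p n \<subseteq> {1..n}" by (auto simp: fixpts_def)
    then show ?thesis using card_mono[of "{1..n}" "fixpts p n"] by simp
  qed
  have "(\<Sum>p\<in>?S. ?f p * r ^ card (fixpts p n))
      = (\<Sum>m\<le>n. \<Sum>p | p \<in> ?S \<and> card (fixpts p n) = m. ?f p * r ^ card (fixpts p n))"
    by (rule sum.group[symmetric]) (use fin card_le in auto)
  also have "\<dots> = (\<Sum>m\<le>n. qbinom q n m * r ^ m * derangement_sum q t (n - m))"
  proof (rule sum.cong)
    fix m assume "m \<in> {..n}"
    then have m: "m \<le> n" by simp
    have "(\<Sum>p | p \<in> ?S \<and> card (fixpts p n) = m. ?f p * r ^ card (fixpts p n))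
      = r ^ m * (\<Sum>p | p \<in> ?S \<and> card (fixpts p n) = m. ?f p)"
      unfolding sum_distrib_left by (rule sum.cong) (auto simp: mult_ac)
    also have "(\<Sum>p | p \<in> ?S \<and> card (fixpts p n) = m. ?f p)
      = (\<Sum>F\<in>subsets_of_card n m. \<Sum>p | p \<in> {p \<in> ?S. card (fixpts p n) = m} \<and> fixpts p n = F. ?f p)"
      by (rule sum.group[symmetric]) (use fin in \<open>auto simp: subsets_of_card_def fixpts_def\<close>)
    also have "\<dots> = (\<Sum>F\<in>subsets_of_card n m. \<Sum>p | p permutes {1..n} \<and> fixpts p n = F. ?f p)"
      by (intro sum.cong) (auto simp: subsets_of_card_def)
    also have "\<dots> = (\<Sum>F\<in>subsets_of_card n m. \<Sum>\<tau>\<in>derangements (n - m).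
          q ^ fmaj (shuffle_key (derangement_key \<tau> (n - m)) F) n * t ^ fexc \<tau> (n - m))"
      by (intro sum.cong refl sum_fixpts_eq)
    \<comment> \<open>With \<tau> held fixed, \<open>F\<close> runs over all placements of
      \<open>m\<close> zeros in one word, the situation of \<open>sum_shuffle_maj\<close>.\<close>
    also have "\<dots> = (\<Sum>\<tau>\<in>derangements (n - m). t ^ fexc \<tau> (n - m) *
        (\<Sum>F\<in>subsets_of_card n m. q ^ fmaj (shuffle_key (derangement_key \<tau> (n - m)) F) n))"
      by (subst sum.swap) (simp add: sum_distrib_left mult.commute)
    also have "\<dots> = (\<Sum>\<tau>\<in>derangements (n - m). t ^ fexc \<tau> (n - m) * (q ^ fmaj \<tau> (n - m) * qbinom q n m))"
    proof (intro sum.cong refl arg_cong2[of _ _ _ _ "(*)"])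
      fix \<tau> assume \<tau>: "\<tau> \<in> derangements (n - m)"
      then have "derangement_key \<tau> (n - m) i \<noteq> 0" for i
        by (simp add: derangements_def derangement_key_sign)
      then show "(\<Sum>F\<in>subsets_of_card n m. q ^ fmaj (shuffle_key (derangement_key \<tau> (n - m)) F) n)
          = q ^ fmaj \<tau> (n - m) * qbinom q n m"
        using m \<tau> by (simp add: sum_shuffle_maj fmaj_derangement_key)
    qed
    finally show "(\<Sum>p | p \<in> ?S \<and> card (fixpts p n) = m. ?f p * r ^ card (fixpts p n))
        = qbinom q n m * r ^ m * derangement_sum q t (n - m)"
      by (simp add: derangement_sum_def sum_distrib_left mult_ac)
  qed simp
  finally show ?thesis by (simp add: qconv_def)
qed

section \<open>Major index, excedances and the cyclic shift\<close>

definition cyclic_shift :: "nat \<Rightarrow> nat \<Rightarrow> nat" where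
  "cyclic_shift n x = (if x \<in> {1..<n} then Suc x else if x = n \<and> 0 < n then 1 else x)"

lemma cyclic_shift_permutes: "cyclic_shift n permutes {1..n}"
proof (rule bij_imp_permutes)
  have "inj_on (cyclic_shift n) {1..n}"
    by (auto simp: inj_on_def cyclic_shift_def split: if_splits)
  moreover have "cyclic_shift n ` {1..n} \<subseteq> {1..n}"
    by (auto simp: cyclic_shift_def)
  ultimately show "bij_betw (cyclic_shift n) {1..n} {1..n}"
    unfolding bij_betw_def by (simp add: endo_inj_surj)
qed (auto simp: cyclic_shift_def)

lemma fmaj_alt: "fmaj f n = (\<Sum>i\<in>{1..<n}. i * of_bool (f i > f (Suc i)))"
proof -
  have "fmaj f n = (\<Sum>i\<in>{1..<n}. if f i > f (Suc i) then i else 0)"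
    unfolding fmaj_def by (subst sum.inter_filter[symmetric]) auto
  also have "\<dots> = (\<Sum>i\<in>{1..<n}. i * of_bool (f i > f (Suc i)))"
    by (rule sum.cong) auto
  finally show ?thesis .
qed

context
  fixes p :: "nat \<Rightarrow> nat" and n :: nat
  assumes p: "p permutes {1..n}" and n: "0 < n"
begin

text \<open>Raising every value by one and sending \<open>n\<close> to 1 changes only comparisons
  next to the position \<open>P\<close> of \<open>n\<close>: the descent at \<open>P\<close>,
  present if \<open>P < n\<close>, disappears, and a descent at \<open>P - 1\<close> appears if
  \<open>P > 1\<close>. The net change is -1, or \<open>n - 1\<close> if
  \<open>P = n\<close>.\<close>

lemma fmaj_cyclic_shift:
  "Suc (fmaj (cyclic_shift n \<circ> p) n) = fmaj p n + (if p n = n then n else 0)"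
proof -
  let ?c = "cyclic_shift n \<circ> p"
  obtain P where P: "P \<in> {1..n}" "p P = n"
    using permutes_image[OF p] n by (metis Suc_leI atLeastAtMost_iff imageE le_refl One_nat_def)
  have pP: "p i = n \<longleftrightarrow> i = P" for i
    using P permutes_inj[OF p] by (metis injD)
  have le: "1 \<le> p i \<and> p i \<le> n" if "1 \<le> i" "i \<le> n" for i
    using permutes_in_image[OF p, of i] that by simp
  \<comment> \<open>Lost and gained descents are added on opposite sides to avoid subtraction of
    naturals.\<close>
  have "(\<Sum>i\<in>{1..<n}. i * of_bool (?c i > ?c (Suc i)) + i * of_bool (i = P))
      = (\<Sum>i\<in>{1..<n}. i * of_bool (p i > p (Suc i)) + i * of_bool (Suc i = P))"
  proof (rule sum.cong)
    fix i assume i: "i \<in> {1..<n}"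
    have "p i \<noteq> p (Suc i)" using permutes_inj[OF p] by (metis injD n_not_Suc_n)
    moreover have "1 \<le> p i" "p i \<le> n" "1 \<le> p (Suc i)" "p (Suc i) \<le> n"
      using le[of i] le[of "Suc i"] i by auto
    ultimately show "i * of_bool (?c i > ?c (Suc i)) + i * of_bool (i = P)
        = i * of_bool (p i > p (Suc i)) + i * of_bool (Suc i = P)"
      unfolding pP[symmetric] by (auto simp: cyclic_shift_def)
  qed simp
  moreover have "(\<Sum>i\<in>{1..<n}. i * of_bool (i = P)) = (if P < n then P else 0)"
    using P by (simp add: of_bool_def if_distrib[of "(*) _"] cong: if_cong)
  moreover have "(\<Sum>i\<in>{1..<n}. i * of_bool (Suc i = P)) = P - 1"
  proof -
    have "(\<Sum>i\<in>{1..<n}. i * of_bool (Suc i = P)) = (\<Sum>i\<in>{1..<n}. if i = P - 1 then i else 0)"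
      using P by (intro sum.cong) auto
    also have "\<dots> = P - 1" using P by (auto simp: sum.delta)
    finally show ?thesis .
  qed
  ultimately have "fmaj ?c n + (if P < n then P else 0) = fmaj p n + (P - 1)"
    by (simp add: fmaj_alt sum.distrib)
  then show ?thesis
    using P by (auto simp: pP)
qed

text \<open>A raised value exceeds \<open>i\<close> iff \<open>p i\<close> is at least
  \<open>i\<close>. The one exception is the position of \<open>n\<close>, always a weak excedance,
  where the new value is 1.\<close>

lemma fexc_cyclic_shift:
  "Suc (fexc (cyclic_shift n \<circ> p) n) = fexc p n + card (fixpts p n)"
proof -
  let ?c = "cyclic_shift n \<circ> p"
  obtain P where P: "P \<in> {1..n}" "p P = n"
    using permutes_image[OF p] n by (metis Suc_leI atLeastAtMost_iff imageE le_refl One_nat_def)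
  have pP: "p i = n \<longleftrightarrow> i = P" for i
    using P permutes_inj[OF p] by (metis injD)
  have le: "1 \<le> p i \<and> p i \<le> n" if "1 \<le> i" "i \<le> n" for i
    using permutes_in_image[OF p, of i] that by simp
  have "{i \<in> {1..n}. p i > i} \<union> fixpts p n = insert P {i \<in> {1..n}. ?c i > i}"
  proof (rule set_eqI)
    fix i
    show "i \<in> {i \<in> {1..n}. p i > i} \<union> fixpts p n \<longleftrightarrow> i \<in> insert P {i \<in> {1..n}. ?c i > i}"
    proof (cases "i = P")
      case True
      then show ?thesis using P by (auto simp: fixpts_def)
    next
      case False
      then have "p i \<noteq> n" by (simp add: pP)
      then show ?thesis using False le[of i] by (auto simp: fixpts_def cyclic_shift_def)
    qed
  qed
  moreover have "P \<notin> {i \<in> {1..n}. ?c i > i}"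
    using P by (auto simp: cyclic_shift_def)
  ultimately have "Suc (fexc ?c n) = card ({i \<in> {1..n}. p i > i} \<union> fixpts p n)"
    by (simp add: fexc_def)
  also have "\<dots> = fexc p n + card (fixpts p n)"
    unfolding fexc_def by (rule card_Un_disjoint) (auto simp: fixpts_def)
  finally show ?thesis .
qed

end

section \<open>The two linear relations for the generating function of \<open>maj\<close> and
  \<open>exc\<close>\<close>

definition maj_exc_sum :: "'a::comm_ring_1 \<Rightarrow> 'a \<Rightarrow> nat \<Rightarrow> 'a" where
  "maj_exc_sum q t n = (\<Sum>p | p permutes {1..n}. q ^ fmaj p n * t ^ fexc p n)"

lemma maj_exc_sum_eq: "maj_exc_sum q t n = qconv q (derangement_sum q t) (\<lambda>_. 1) n"
  using sum_maj_exc_fix[where r = 1 and q = q and t = t and n = n]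
  by (simp add: maj_exc_sum_def qconv_commute[of q "\<lambda>_. 1"])

lemma sum_maj_wexc:
  "(\<Sum>p | p permutes {1..n}. q ^ fmaj p n * t ^ (fexc p n + card (fixpts p n)))
    = qconv q (derangement_sum q t) (\<lambda>k. t ^ k) n"
  using sum_maj_exc_fix[where r = t and q = q and t = t and n = n]
  by (simp add: power_add mult.assoc qconv_commute[of q "\<lambda>k. t ^ k"])

lemma permutes_Suc_fix: "{p. p permutes {1..Suc n} \<and> p (Suc n) = Suc n} = {p. p permutes {1..n}}"
proof (intro Collect_cong iffI)
  fix p assume p: "p permutes {1..Suc n} \<and> p (Suc n) = Suc n"
  show "p permutes {1..n}"
    by (rule permutes_superset[of _ "{1..Suc n}"]) (use p in \<open>auto simp: le_Suc_eq\<close>)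
next
  fix p assume "p permutes {1..n}"
  then show "p permutes {1..Suc n} \<and> p (Suc n) = Suc n"
    using permutes_not_in[of p "{1..n}" "Suc n"] permutes_subset[of p "{1..n}" "{1..Suc n}"] by auto
qed

text \<open>Composing with the cyclic shift turns weak excedances into excedances, except that the position of \<open>n\<close>
  is lost, and lowers \<open>maj\<close> by one, up to a correction when \<open>n\<close> is a fixed point.\<close>

lemma maj_exc_sum_shift:
  "q * t * maj_exc_sum q t (Suc n) = qconv q (derangement_sum q t) (\<lambda>k. (q * t) ^ k) (Suc n)"
proof -
  let ?S = "{p. p permutes {1..Suc n}}" and ?D = "derangement_sum q t"
  let ?N = "Suc n" and ?c = "cyclic_shift (Suc n)"
  let ?g = "\<lambda>p n. q ^ fmaj p n * t ^ (fexc p n + card (fixpts p n))"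
  have fin: "finite ?S" by (simp add: finite_permutations)
  have "q * t * maj_exc_sum q t ?N
      = (\<Sum>p\<in>?S. q * t * (q ^ fmaj (?c \<circ> p) ?N * t ^ fexc (?c \<circ> p) ?N))"
    unfolding maj_exc_sum_def
    by (subst setum_permutations_compose_left[OF cyclic_shift_permutes[of ?N]]) (rule sum_distrib_left)
  also have "\<dots> = (\<Sum>p\<in>?S. ?g p ?N + (q ^ ?N - 1) * (if p ?N = ?N then ?g p ?N else 0))"
  proof (rule sum.cong)
    fix p assume "p \<in> ?S"
    then have p: "p permutes {1..?N}" by simp
    have "q * t * (q ^ fmaj (?c \<circ> p) ?N * t ^ fexc (?c \<circ> p) ?N)
        = q ^ Suc (fmaj (?c \<circ> p) ?N) * t ^ Suc (fexc (?c \<circ> p) ?N)"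
      by (simp add: mult_ac)
    also have "\<dots> = ?g p ?N + (q ^ ?N - 1) * (if p ?N = ?N then ?g p ?N else 0)"
      unfolding fmaj_cyclic_shift[OF p zero_less_Suc] fexc_cyclic_shift[OF p zero_less_Suc]
      by (simp add: power_add algebra_simps)
    finally show "q * t * (q ^ fmaj (?c \<circ> p) ?N * t ^ fexc (?c \<circ> p) ?N)
        = ?g p ?N + (q ^ ?N - 1) * (if p ?N = ?N then ?g p ?N else 0)" .
  qed simp
  also have "\<dots> = qconv q ?D (\<lambda>k. t ^ k) ?N + (q ^ ?N - 1) * (\<Sum>p\<in>?S. if p ?N = ?N then ?g p ?N else 0)"
    by (simp only: sum.distrib sum_distrib_left sum_maj_wexc)
  also have "(\<Sum>p\<in>?S. if p ?N = ?N then ?g p ?N else 0) = (\<Sum>p | p permutes {1..?N} \<and> p ?N = ?N. ?g p ?N)"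
    using fin by (subst sum.inter_filter[symmetric]) auto
  also have "\<dots> = (\<Sum>p | p permutes {1..n}. t * ?g p n)"
    unfolding permutes_Suc_fix
  proof (rule sum.cong)
    fix p assume "p \<in> {p. p permutes {1..n}}"
    then have p: "p permutes {1..n}" by simp
    then have N: "p ?N = ?N" using permutes_not_in[of p "{1..n}" ?N] by simp
    have "p n \<le> n" using permutes_in_image[OF p, of n] permutes_not_in[OF p, of n] by (cases "n = 0") auto
    then have 1: "fmaj p ?N = fmaj p n" using N by (simp add: fmaj_Suc)
    have 2: "fexc p ?N = fexc p n"
      unfolding fexc_def using N by (intro arg_cong[of _ _ card]) (auto simp: le_Suc_eq)
    have "fixpts p ?N = insert ?N (fixpts p n)" "?N \<notin> fixpts p n" "finite (fixpts p n)"
      using N by (auto simp: fixpts_def le_Suc_eq)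
    then have 3: "card (fixpts p ?N) = Suc (card (fixpts p n))" by simp
    show "?g p ?N = t * ?g p n" unfolding 1 2 3 by (simp add: mult_ac)
  qed simp
  also have "\<dots> = t * qconv q ?D (\<lambda>k. t ^ k) n"
    by (simp only: sum_distrib_left[symmetric] sum_maj_wexc)
  \<comment> \<open>Absorption turns the correction from permutations with last letter fixed into a
    multiple \<open>q ^ (?N - k) - 1\<close> of the \<open>k\<close>-th term of the main
    convolution. Adding the two replaces \<open>t ^ (?N - k)\<close> by
    \<open>(q * t) ^ (?N - k)\<close>.\<close>
  also have "(q ^ ?N - 1) * (t * qconv q ?D (\<lambda>k. t ^ k) n)
      = (\<Sum>k\<le>n. (q ^ (?N - k) - 1) * qbinom q ?N k * ?D k * t ^ (?N - k))"
    unfolding qconv_def sum_distrib_left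
  proof (rule sum.cong)
    fix k assume k: "k \<in> {..n}"
    then have "(q ^ ?N - 1) * (t * (qbinom q n k * ?D k * t ^ (n - k)))
        = ((q ^ ?N - 1) * qbinom q n k) * ?D k * t ^ (?N - k)"
      by (simp add: Suc_diff_le mult_ac)
    then show "(q ^ ?N - 1) * (t * (qbinom q n k * ?D k * t ^ (n - k)))
        = (q ^ (?N - k) - 1) * qbinom q ?N k * ?D k * t ^ (?N - k)"
      using qbinom_absorb[of k n q] k by simp
  qed simp
  \<comment> \<open>The new summand \<open>k = ?N\<close> has the factor
    \<open>q ^ 0 - 1 = 0\<close>.\<close>
  also have "\<dots> = (\<Sum>k\<le>?N. (q ^ (?N - k) - 1) * qbinom q ?N k * ?D k * t ^ (?N - k))"
    by simp
  also have "qconv q ?D (\<lambda>k. t ^ k) ?N + \<dots> = qconv q ?D (\<lambda>k. (q * t) ^ k) ?N"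
    unfolding qconv_def sum.distrib[symmetric]
    by (rule sum.cong) (simp_all add: power_mult_distrib algebra_simps del: qbinom.simps)
  finally show ?thesis .
qed

lemma derangement_sum_0: "derangement_sum q t 0 = 1"
proof -
  have "derangements 0 = {id}"
    by (auto simp: derangements_def fixpts_def)
  then show ?thesis by (simp add: derangement_sum_def fexc_def)
qed

lemma maj_exc_sum_0: "maj_exc_sum q t 0 = 1"
  by (simp add: maj_exc_sum_def fexc_def)

lemma maj_exc_sum_Suc:
  fixes q t :: "'a::idom"
  assumes "q * t \<noteq> 1"
  shows "maj_exc_sum q t (Suc n) = maj_exc_sum q t n
    + q * t * qconv q (\<lambda>k. maj_exc_sum q t k - qunit k) (\<lambda>k. q ^ k * maj_exc_sum q t k) n"
proof (rule qexp_quotient_Suc[where D = "derangement_sum q t"])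
  fix n :: nat assume "0 < n"
  then show "qconv q (derangement_sum q t) (\<lambda>k. (q * t) ^ k) n = q * t * maj_exc_sum q t n"
    by (cases n) (simp_all only: maj_exc_sum_shift)
qed (use assms in \<open>simp_all add: derangement_sum_0 maj_exc_sum_eq\<close>)

section \<open>From permutations as functions to one-line notation\<close>

lemma perms_eq: "perms n = permutations_of_set {1..n}"
  by (auto simp: perms_def permutations_of_set_def)

lemma sum_perms_maj_exc: "(\<Sum>s\<in>perms n. q ^ maj s * t ^ exc s) = maj_exc_sum q t n"
proof -
  let ?f = "\<lambda>p. map p [1..<Suc n]" and ?S = "{p. p permutes {1..n}}"
  have ent: "ent (?f p) i = p i" if "1 \<le> i" "i \<le> n" for p :: "nat \<Rightarrow> nat" and i
    using that by (simp del: upt_Suc)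
  have inj: "inj_on ?f ?S"
  proof (rule inj_onI)
    fix p p' assume *: "p \<in> ?S" "p' \<in> ?S" "?f p = ?f p'"
    show "p = p'"
    proof
      fix i
      show "p i = p' i"
      proof (cases "i \<in> {1..n}")
        case True
        then show ?thesis using *(3) ent[of i p] ent[of i p'] by (metis atLeastAtMost_iff)
      next
        case False
        then show ?thesis using *(1,2) permutes_not_in by (metis mem_Collect_eq)
      qed
    qed
  qed
  have "?f ` ?S \<subseteq> perms n"
  proof safe
    fix p assume p: "p permutes {1..n}"
    have "distinct (?f p)"
      using permutes_inj_on[OF p] by (simp add: distinct_map del: upt_Suc)
    moreover have "set (?f p) = {1..n}"
      using permutes_image[OF p] by (simp add: atLeastLessThanSuc_atLeastAtMost del: upt_Suc)
    ultimately show "?f p \<in> perms n" by (simp add: perms_def)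
  qed
  moreover have "card (?f ` ?S) = card (perms n)"
    using card_image[OF inj] card_permutations[of "{1..n}" n] by (simp add: perms_eq del: upt_Suc)
  ultimately have "bij_betw ?f ?S (perms n)"
    using inj unfolding bij_betw_def by (metis card_subset_eq perms_eq finite_permutations_of_set)
  then have "(\<Sum>s\<in>perms n. q ^ maj s * t ^ exc s) = (\<Sum>p\<in>?S. q ^ maj (?f p) * t ^ exc (?f p))"
    by (rule sum.reindex_bij_betw[symmetric])
  also have "\<dots> = maj_exc_sum q t n"
    unfolding maj_exc_sum_def
  proof (rule sum.cong)
    fix p
    have "Des (?f p) = {i. i \<in> {1..<n} \<and> p i > p (Suc i)}"
      unfolding Des_def using ent[of _ p] ent[of "Suc _" p] by (auto simp del: upt_Suc)
    then have "maj (?f p) = fmaj p n" by (simp add: maj_def fmaj_def)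
    moreover have "exc (?f p) = fexc p n"
      unfolding exc_def fexc_def using ent[of _ p]
      by (intro arg_cong[of _ _ card]) (auto simp del: upt_Suc)
    ultimately show "q ^ maj (?f p) * t ^ exc (?f p) = q ^ fmaj p n * t ^ fexc p n" by simp
  qed simp
  finally show ?thesis .
qed

section \<open>Admissible inversions and the position of the maximum\<close>

definition cross_inv :: "nat set \<Rightarrow> nat set \<Rightarrow> nat" where
  "cross_inv A B = card {(x, y). x \<in> A \<and> y \<in> B \<and> x > y}"

text \<open>Consider the largest element \<open>M\<close>. Outside \<open>A\<close> it is in no
  counted pair; inside \<open>A\<close> it is paired with every element of the complement, which
  gives the exponent \<open>card S - j\<close> of the second Pascal rule.\<close>

lemma sum_cross_inv:
  assumes "finite S"
  shows "(\<Sum>A | A \<subseteq> S \<and> card A = k. q ^ cross_inv A (S - A)) = (qbinom q (card S) k :: 'a::comm_ring_1)"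
  using assms
proof (induction S arbitrary: k rule: finite_linorder_max_induct)
  case empty
  have "{A. A \<subseteq> ({} :: nat set) \<and> card A = k} = (if k = 0 then {{}} else {})" by auto
  then show ?case by (cases k) (simp_all only: cross_inv_def, simp_all)
next
  case (insert M S)
  have M: "M \<notin> S" using insert.hyps by blast
  let ?I = "insert M S"
  show ?case
  proof (cases k)
    case 0
    have *: "{A. A \<subseteq> ?I \<and> card A = 0} = {{}}"
      using insert.hyps(1) finite_subset[of _ ?I] by fastforce
    show ?thesis unfolding 0 * by (simp add: cross_inv_def)
  next
    case k: (Suc j)
    let ?F = "\<lambda>k. {A. A \<subseteq> S \<and> card A = k}"
    have fin: "finite (?F k)" for k
      using insert.hyps(1) by (auto intro: finite_subset[of _ "Pow S"])
    have split: "{A. A \<subseteq> ?I \<and> card A = k} = ?F (Suc j) \<union> insert M ` ?F j"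
    proof (intro subset_antisym subsetI)
      fix A assume A: "A \<in> {A. A \<subseteq> ?I \<and> card A = k}"
      show "A \<in> ?F (Suc j) \<union> insert M ` ?F j"
      proof (cases "M \<in> A")
        case True
        then have "A = insert M (A - {M})" by auto
        moreover have "A - {M} \<in> ?F j"
          using A True k insert.hyps(1) by (auto dest: finite_subset)
        ultimately show ?thesis by blast
      qed (use A k in auto)
    next
      fix A assume "A \<in> ?F (Suc j) \<union> insert M ` ?F j"
      then show "A \<in> {A. A \<subseteq> ?I \<and> card A = k}"
      proof
        assume "A \<in> insert M ` ?F j"
        then obtain B where B: "A = insert M B" "B \<subseteq> S" "card B = j" by auto
        then have "finite B" "M \<notin> B" using insert.hyps(1) M by (auto dest: finite_subset)
        then show ?thesis using B k by auto
      qed (use k in auto)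
    qed
    have inj: "inj_on (insert M) (?F j)"
      using M by (intro inj_onI) (metis (no_types, lifting) insert_ident mem_Collect_eq subsetD)
    have 1: "cross_inv A (?I - A) = cross_inv A (S - A)" if "A \<in> ?F (Suc j)" for A
      unfolding cross_inv_def using insert.hyps(2) that
      by (intro arg_cong[of _ _ card]) (auto dest: less_asym)
    have 2: "cross_inv (insert M A) (?I - insert M A) = card S - j + cross_inv A (S - A)" if "A \<in> ?F j" for A
    proof -
      have A: "A \<subseteq> S" "card A = j" "finite A" using that insert.hyps(1) by (auto dest: finite_subset)
      have "{(x, y). x \<in> insert M A \<and> y \<in> ?I - insert M A \<and> x > y}
          = Pair M ` (S - A) \<union> {(x, y). x \<in> A \<and> y \<in> S - A \<and> x > y}"
        using insert.hyps(2) A M by auto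
      moreover have "card \<dots> = card (Pair M ` (S - A)) + card {(x, y). x \<in> A \<and> y \<in> S - A \<and> x > y}"
      proof (rule card_Un_disjoint)
        show "finite {(x, y). x \<in> A \<and> y \<in> S - A \<and> x > y}"
          by (rule finite_subset[of _ "A \<times> S"]) (use A insert.hyps(1) in auto)
      qed (use A M insert.hyps(1) in auto)
      moreover have "card (Pair M ` (S - A)) = card S - j"
        using A by (simp add: card_image inj_on_def card_Diff_subset)
      ultimately show ?thesis by (simp add: cross_inv_def)
    qed
    have "(\<Sum>A | A \<subseteq> ?I \<and> card A = k. q ^ cross_inv A (?I - A))
        = (\<Sum>A\<in>?F (Suc j). q ^ cross_inv A (?I - A))
          + (\<Sum>A\<in>insert M ` ?F j. q ^ cross_inv A (?I - A))"
      unfolding split by (rule sum.union_disjoint) (use fin M in auto)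
    also have "(\<Sum>A\<in>?F (Suc j). q ^ cross_inv A (?I - A)) = qbinom q (card S) (Suc j)"
      using insert.IH[of "Suc j"] by (simp add: 1 del: qbinom.simps)
    also have "(\<Sum>A\<in>insert M ` ?F j. q ^ cross_inv A (?I - A))
        = (\<Sum>A\<in>?F j. q ^ (card S - j) * q ^ cross_inv A (S - A))"
      by (subst sum.reindex[OF inj], rule sum.cong) (simp_all only: o_def 2 power_add)
    also have "\<dots> = q ^ (card S - j) * qbinom q (card S) j"
      using insert.IH[of j] by (simp flip: sum_distrib_left)
    also have "qbinom q (card S) (Suc j) + \<dots> = qbinom q (card ?I) k"
    proof (cases "j \<le> card S")
      case True
      then show ?thesis
        using qbinom_Suc_Suc'[OF True, of q] insert.hyps(1) M k by (simp del: qbinom.simps add: add.commute)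
    qed (use insert.hyps(1) M k in \<open>simp add: qbinom_eq_0\<close>)
    finally show ?thesis .
  qed
qed

context
  fixes \<alpha> \<beta> :: "nat list" and M :: nat
  assumes less: "\<And>x. x \<in> set \<alpha> \<union> set \<beta> \<Longrightarrow> x < M"
begin

private abbreviation "s \<equiv> \<alpha> @ M # \<beta>"
private abbreviation "K \<equiv> length \<alpha>"

private lemma ent_left: "1 \<le> i \<Longrightarrow> i \<le> K \<Longrightarrow> ent s i = ent \<alpha> i"
  by (auto simp: nth_append)

private lemma ent_mid: "ent s (Suc K) = M"
  by simp

private lemma ent_right: "1 \<le> i \<Longrightarrow> ent s (i + Suc K) = ent \<beta> i"
  by (cases i) (auto simp: nth_append)

private lemma ent_left_less: "1 \<le> i \<Longrightarrow> i \<le> K \<Longrightarrow> ent \<alpha> i < M"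
  by (intro less UnI1 nth_mem) auto

private lemma ent_right_less: "1 \<le> i \<Longrightarrow> i \<le> length \<beta> \<Longrightarrow> ent \<beta> i < M"
  by (intro less UnI2 nth_mem) auto

private lemma position_cases:
  assumes "1 \<le> i" "i \<le> length s"
  obtains (left) "i \<le> K" | (mid) "i = Suc K"
  | (right) j where "i = j + Suc K" "1 \<le> j" "j \<le> length \<beta>"
proof -
  consider "i \<le> K" | "i = Suc K" | "i > Suc K" by linarith
  then show thesis
  proof cases
    case 3
    then show thesis using assms right[of "i - Suc K"] by simp
  qed (use left mid in auto)
qed

text \<open>The maximum ends an ascent if something precedes it and begins a descent if something
  follows it; all other comparisons stay inside one block.\<close>

lemma des_max_split: "des (\<alpha> @ M # \<beta>) = des \<alpha> + des \<beta> + of_bool (\<beta> \<noteq> [])"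
proof -
  let ?mid = "if \<beta> = [] then {} else {Suc K}"
  have "Des s = Des \<alpha> \<union> ?mid \<union> (\<lambda>i. i + Suc K) ` Des \<beta>" (is "_ = ?R")
  proof (rule set_eqI)
    fix i
    have img: "i \<in> (\<lambda>i. i + Suc K) ` Des \<beta> \<longleftrightarrow> i > Suc K \<and> i - Suc K \<in> Des \<beta>"
      by (auto simp: Des_def image_iff intro: bexI[of _ "i - Suc K"])
    consider "i = 0" | "1 \<le> i" "i < K" | "1 \<le> i" "i = K" | "i = Suc K" | j where "i = j + Suc K" "1 \<le> j"
      by (metis One_nat_def Suc_leI add.commute less_Suc_eq less_imp_Suc_add linorder_neqE_nat not_gr0 plus_1_eq_Suc zero_less_Suc add_Suc_right)
    then show "i \<in> Des s \<longleftrightarrow> i \<in> ?R"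
    proof cases
      case 1
      then show ?thesis by (auto simp: Des_def)
    next
      case 2
      then show ?thesis unfolding Un_iff img
        using ent_left[of i] ent_left[of "Suc i"] by (auto simp: Des_def)
    next
      case 3
      then show ?thesis unfolding Un_iff img
        using ent_left[of i] ent_mid ent_left_less[of i] by (auto simp: Des_def)
    next
      case 4
      have "\<beta> \<noteq> [] \<Longrightarrow> ent s (Suc (Suc K)) < M"
        using ent_right[of 1] ent_right_less[of 1] by (cases \<beta>) auto
      then show ?thesis unfolding Un_iff img
        using 4 ent_mid by (auto simp: Des_def)
    next
      case 5
      then show ?thesis unfolding Un_iff img
        using ent_right[of j] ent_right[of "Suc j"] by (auto simp: Des_def)
    qed
  qed
  moreover have "card ?R = card (Des \<alpha> \<union> ?mid) + card ((\<lambda>i. i + Suc K) ` Des \<beta>)"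
    by (rule card_Un_disjoint) (auto simp: Des_def)
  moreover have "card (Des \<alpha> \<union> ?mid) = card (Des \<alpha>) + card ?mid"
    by (rule card_Un_disjoint) (auto simp: Des_def)
  moreover have "card ((\<lambda>i. i + Suc K) ` Des \<beta>) = card (Des \<beta>)"
    by (rule card_image) (auto simp: inj_on_def)
  ultimately show ?thesis by (simp add: des_def)
qed

private lemma admissible_left:
  assumes "j \<le> K"
  shows "admissible_inv s i j \<longleftrightarrow> admissible_inv \<alpha> i j"
proof (cases "1 \<le> i \<and> i < j")
  case True
  have "ent s (i - 1) = ent \<alpha> (i - 1)" if "1 < i"
    using ent_left[of "i - 1"] True assms that by simp
  moreover have "ent s k = ent \<alpha> k" if "i \<le> k" "k \<le> j" for k
    using ent_left[of k] True assms that by simp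
  ultimately show ?thesis
    using True assms unfolding admissible_inv_def
    by (auto simp del: One_nat_def)
qed (auto simp: admissible_inv_def)

private lemma admissible_right:
  assumes "1 \<le> i"
  shows "admissible_inv s (i + Suc K) (j + Suc K) \<longleftrightarrow> admissible_inv \<beta> i j"
proof (cases "i < j \<and> j \<le> length \<beta>")
  case True
  \<comment> \<open>The first letter of \<beta> is now preceded by the larger \<open>M\<close>, so
    the predecessor clause fails there, just as it does at position 1 of \<beta> alone.\<close>
  have pred: "ent s (i + Suc K - 1) < ent s (i + Suc K) \<longleftrightarrow> i > 1 \<and> ent \<beta> (i - 1) < ent \<beta> i"
  proof (cases "i = 1")
    case i1: True
    have "ent s (1 + Suc K) < ent s (Suc K)"
      using ent_right[of 1] ent_right_less[of 1] True i1 by simp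
    then show ?thesis using i1 by auto
  next
    case False
    then have "ent s (i + Suc K - 1) = ent \<beta> (i - 1)"
      using ent_right[of "i - 1"] assms by simp
    then show ?thesis using False assms ent_right[of i] by simp
  qed
  have betw: "(\<exists>k. i + Suc K < k \<and> k < j + Suc K \<and> ent s (i + Suc K) < ent s k)
      \<longleftrightarrow> (\<exists>k. i < k \<and> k < j \<and> ent \<beta> i < ent \<beta> k)" (is "?L \<longleftrightarrow> ?R")
  proof
    assume ?L
    then obtain k where k: "i + Suc K < k" "k < j + Suc K" "ent s (i + Suc K) < ent s k" by blast
    then have "ent s k = ent \<beta> (k - Suc K)" using ent_right[of "k - Suc K"] assms by simp
    then show ?R using k ent_right[OF assms] by (intro exI[of _ "k - Suc K"]) auto
  next
    assume ?R
    then obtain k where "i < k" "k < j" "ent \<beta> i < ent \<beta> k" by blast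
    then show ?L using ent_right[of i] ent_right[of k] assms by (intro exI[of _ "k + Suc K"]) auto
  qed
  have e: "ent s (j + Suc K) = ent \<beta> j" "ent s (i + Suc K) = ent \<beta> i"
    using ent_right[of j] ent_right[of i] assms True by auto
  show ?thesis
    unfolding admissible_inv_def betw pred unfolding e using True assms by auto
qed (auto simp: admissible_inv_def)

text \<open>The maximum stands between the two letters and serves as the larger entry at
  \<open>k\<close>.\<close>

private lemma admissible_cross:
  assumes "1 \<le> i" "i \<le> K" "1 \<le> j" "j \<le> length \<beta>"
  shows "admissible_inv s i (j + Suc K) \<longleftrightarrow> ent \<alpha> i > ent \<beta> j"
proof -
  have "ent s i < ent s (Suc K)" using ent_left[of i] ent_left_less[of i] ent_mid assms by simp
  then have "\<exists>k. i < k \<and> k < j + Suc K \<and> ent s i < ent s k"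
    using assms by (intro exI[of _ "Suc K"]) auto
  then show ?thesis
    unfolding admissible_inv_def ent_right[OF assms(3)] ent_left[OF assms(1,2)]
    using assms by auto
qed

text \<open>No letter exceeds the maximum, so only the predecessor clause can apply, and it holds as
  soon as a predecessor exists.\<close>

private lemma admissible_mid:
  assumes "1 \<le> j" "j \<le> length \<beta>"
  shows "admissible_inv s (Suc K) (j + Suc K) \<longleftrightarrow> \<alpha> \<noteq> []"
proof -
  have 1: "ent s (Suc K - 1) < ent s (Suc K)" if "\<alpha> \<noteq> []"
  proof -
    have "1 \<le> K" using that by (cases \<alpha>) auto
    then show ?thesis using ent_left[of K] ent_left_less[of K] by simp
  qed
  have 2: "\<not> ent s (Suc K) < ent s k" if "Suc K < k" "k < j + Suc K" for k
  proof -
    have "1 \<le> k - Suc K" "k - Suc K \<le> length \<beta>" using that assms by auto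
    then show ?thesis
      using ent_right[of "k - Suc K"] ent_right_less[of "k - Suc K"] that ent_mid by simp
  qed
  have 3: "ent s (j + Suc K) < ent s (Suc K)"
    using ent_right[of j] ent_right_less[of j] assms by simp
  show ?thesis
    unfolding admissible_inv_def using 1 2 3 assms by auto
qed

private lemma not_admissible_to_mid: "\<not> admissible_inv s i (Suc K)"
  using ent_left[of i] ent_left_less[of i] ent_mid by (auto simp: admissible_inv_def)

private lemma finite_admissible: "finite {(i, j). admissible_inv xs i j}"
  by (rule finite_subset[of _ "{..length xs} \<times> {..length xs}"]) (auto simp: admissible_inv_def)

text \<open>Admissible inversions are sorted by where their ends lie relative to the maximum: both
  left (\<open>?A\<close>), both right (\<open>?B\<close>), across (\<open>?C\<close>), or starting
  at it (\<open>?D\<close>). None ends at the maximum.\<close>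

lemma ai_max_split:
  assumes "distinct (\<alpha> @ M # \<beta>)"
  shows "ai (\<alpha> @ M # \<beta>) = ai \<alpha> + ai \<beta> + cross_inv (set \<alpha>) (set \<beta>)
    + (if \<alpha> = [] then 0 else length \<beta>)"
proof -
  let ?sh = "\<lambda>i. i + Suc K"
  let ?A = "{(i, j). admissible_inv \<alpha> i j}"
  let ?B = "map_prod ?sh ?sh ` {(i, j). admissible_inv \<beta> i j}"
  let ?X = "{(i, j). i \<in> {1..K} \<and> j \<in> {1..length \<beta>} \<and> ent \<alpha> i > ent \<beta> j}"
  let ?C = "map_prod id ?sh ` ?X"
  let ?D = "if \<alpha> = [] then {} else (\<lambda>j. (Suc K, ?sh j)) ` {1..length \<beta>}"
  have finX: "finite ?X"
    by (rule finite_subset[of _ "{1..K} \<times> {1..length \<beta>}"]) auto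
  have "{(i, j). admissible_inv s i j} = (?A \<union> ?B) \<union> (?C \<union> ?D)"
  proof (intro subset_antisym subsetI)
    fix z assume z: "z \<in> {(i, j). admissible_inv s i j}"
    then obtain i j where ij: "z = (i, j)" "admissible_inv s i j" by auto
    then have rng: "1 \<le> i" "i < j" "j \<le> length s" by (auto simp: admissible_inv_def)
    then have "1 \<le> j" by simp
    from this rng(3) show "z \<in> (?A \<union> ?B) \<union> (?C \<union> ?D)"
    proof (cases j rule: position_cases)
      case left
      then show ?thesis using ij admissible_left by simp
    next
      case mid
      then show ?thesis using ij not_admissible_to_mid by simp
    next
      case (right j')
      have "i \<le> length s" using rng by simp
      with rng(1) show ?thesis
      proof (cases i rule: position_cases)
        case left
        then have "(i, j') \<in> ?X" using admissible_cross rng right ij by auto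
        then have "z \<in> ?C" using ij right by (force simp: image_iff)
        then show ?thesis by blast
      next
        case mid
        then have "\<alpha> \<noteq> []" using admissible_mid right ij by blast
        then have "z \<in> ?D" using mid right ij by auto
        then show ?thesis by blast
      next
        case r: (right i')
        then have "admissible_inv \<beta> i' j'" using admissible_right right ij by blast
        then have "z \<in> ?B" using ij right r by (force simp: image_iff)
        then show ?thesis by blast
      qed
    qed
  next
    fix z assume "z \<in> (?A \<union> ?B) \<union> (?C \<union> ?D)"
    then consider "z \<in> ?A" | "z \<in> ?B" | "z \<in> ?C" | "z \<in> ?D" by blast
    then show "z \<in> {(i, j). admissible_inv s i j}"
    proof cases
      case 1
      then obtain i j where ij: "z = (i, j)" "admissible_inv \<alpha> i j" by auto
      then have "j \<le> K" by (simp add: admissible_inv_def)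
      then show ?thesis using ij admissible_left by simp
    next
      case 2
      then obtain i j where ij: "z = (?sh i, ?sh j)" "admissible_inv \<beta> i j" by auto
      then have "1 \<le> i" by (simp add: admissible_inv_def)
      then show ?thesis using ij admissible_right by blast
    next
      case 3
      then obtain i j where "z = (i, ?sh j)" "(i, j) \<in> ?X" by auto
      then show ?thesis using admissible_cross by auto
    next
      case 4
      then obtain j where "\<alpha> \<noteq> []" "z = (Suc K, ?sh j)" "j \<in> {1..length \<beta>}"
        by (auto split: if_splits)
      then show ?thesis using admissible_mid by auto
    qed
  qed
  moreover have "card ((?A \<union> ?B) \<union> (?C \<union> ?D)) = card (?A \<union> ?B) + card (?C \<union> ?D)"
    by (rule card_Un_disjoint) (use finX finite_admissible in \<open>auto simp: admissible_inv_def\<close>)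
  moreover have "card (?A \<union> ?B) = card ?A + card ?B"
    by (rule card_Un_disjoint) (use finite_admissible in \<open>auto simp: admissible_inv_def\<close>)
  moreover have "card (?C \<union> ?D) = card ?C + card ?D"
    by (rule card_Un_disjoint) (use finX in auto)
  moreover have "card ?B = ai \<beta>"
    unfolding ai_def by (rule card_image) (auto simp: inj_on_def)
  moreover have "card ?D = (if \<alpha> = [] then 0 else length \<beta>)"
    by (simp add: card_image inj_on_def)
  moreover have "card ?C = card ?X"
    by (rule card_image) (auto simp: inj_on_def)
  moreover have "card ?X = cross_inv (set \<alpha>) (set \<beta>)"
    unfolding cross_inv_def
  \<comment> \<open>Because the letters are distinct, pairs of positions can be read as pairs of
    values.\<close>
  proof (rule bij_betw_same_card[of "map_prod (ent \<alpha>) (ent \<beta>)"], rule bij_betw_imageI)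
    show "inj_on (map_prod (ent \<alpha>) (ent \<beta>)) ?X"
      using assms by (auto simp: inj_on_def nth_eq_iff_index_eq)
    have set: "set xs = ent xs ` {1..length xs}" for xs :: "nat list"
    proof -
      have "{..<length xs} = (\<lambda>i. i - 1) ` {1..length xs}"
        by (force simp: image_iff intro: bexI[of _ "Suc _"])
      then show ?thesis by (simp add: set_conv_nth image_image lessThan_def[symmetric] setcompr_eq_image)
    qed
    show "map_prod (ent \<alpha>) (ent \<beta>) ` ?X = {(x, y). x \<in> set \<alpha> \<and> y \<in> set \<beta> \<and> x > y}"
      unfolding set by (auto simp: image_iff)
  qed
  ultimately show ?thesis by (simp add: ai_def)
qed

end

section \<open>Recursion for admissible inversions and descents\<close>

text \<open>Indexed by the set of letters because the blocks around a maximum use arbitrary subsets;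
  this avoids standardising them. That only the cardinality matters comes out of
  \<open>aid_des_sum_unique\<close>.\<close>

definition aid_des_sum :: "'a::comm_ring_1 \<Rightarrow> 'a \<Rightarrow> nat set \<Rightarrow> 'a" where
  "aid_des_sum q t S = (\<Sum>xs\<in>permutations_of_set S. q ^ aid xs * t ^ des xs)"

text \<open>The part of \<open>q ^ aid * t ^ des\<close> contributed by a maximum with \<open>a\<close> letters before and
  \<open>b\<close> letters after it: one descent if \<open>b > 0\<close>, and \<open>b\<close> admissible inversions if moreover \<open>a > 0\<close>.
  All inversions across the maximum are admissible.\<close>

definition split_weight :: "'a::comm_ring_1 \<Rightarrow> 'a \<Rightarrow> nat \<Rightarrow> nat \<Rightarrow> 'a" where
  "split_weight q t a b = (if b = 0 then 1 else q * t * (if a = 0 then 1 else q ^ b))"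

lemma split_list_takeWhile:
  assumes "x \<in> set xs"
  shows "takeWhile (\<lambda>y. y \<noteq> x) xs @ x # tl (dropWhile (\<lambda>y. y \<noteq> x) xs) = xs"
proof -
  let ?d = "dropWhile (\<lambda>y. y \<noteq> x) xs"
  have ne: "?d \<noteq> []" using assms by auto
  then have "hd ?d = x" using hd_dropWhile[OF ne] by simp
  with ne have "x # tl ?d = ?d" using list.collapse[of ?d] by simp
  then show ?thesis by simp
qed

text \<open>The set \<open>A\<close> of letters before the maximum is carried along so that the sum
  over the two blocks factors once \<open>A\<close> is fixed.\<close>

lemma bij_betw_split_max:
  assumes "M \<notin> S"
  shows "bij_betw (\<lambda>(A, \<alpha>, \<beta>). \<alpha> @ M # \<beta>)
    (SIGMA A:Pow S. permutations_of_set A \<times> permutations_of_set (S - A))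
    (permutations_of_set (insert M S))"
    (is "bij_betw _ ?T _")
proof (rule bij_betw_byWitness[where f' = "\<lambda>xs.
      (set (takeWhile (\<lambda>x. x \<noteq> M) xs), takeWhile (\<lambda>x. x \<noteq> M) xs, tl (dropWhile (\<lambda>x. x \<noteq> M) xs))"],
    goal_cases)
  case 1
  show ?case
  proof (clarify, goal_cases)
    case (1 A \<alpha> \<beta>)
    then have "\<forall>x\<in>set \<alpha>. x \<noteq> M" and "set \<alpha> = A"
      using assms by (auto dest: permutations_of_setD)
    then show ?case by (auto simp: takeWhile_append dropWhile_append)
  qed
next
  case 2
  show ?case
  proof (clarify, goal_cases)
    case (1 xs)
    then have "M \<in> set xs" by (auto dest: permutations_of_setD)
    then show ?case by (simp add: split_list_takeWhile)
  qed
next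
  case 3
  show ?case
    using assms by (auto simp: permutations_of_set_def)
next
  case 4
  show ?case
  proof (rule image_subsetI)
    fix xs assume "xs \<in> permutations_of_set (insert M S)"
    then have xs: "distinct xs" "set xs = insert M S" by (auto dest: permutations_of_setD)
    define \<alpha> \<beta> where "\<alpha> = takeWhile (\<lambda>x. x \<noteq> M) xs" and "\<beta> = tl (dropWhile (\<lambda>x. x \<noteq> M) xs)"
    have "xs = \<alpha> @ M # \<beta>"
      unfolding \<alpha>_def \<beta>_def using xs by (simp add: split_list_takeWhile)
    then show "(set \<alpha>, \<alpha>, \<beta>) \<in> ?T"
      using xs assms
      by (auto simp: permutations_of_set_def)
  qed
qed

lemma aid_des_sum_insert_max:
  assumes fin: "finite S" and M: "\<And>x. x \<in> S \<Longrightarrow> x < M"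
  shows "aid_des_sum q t (insert M S) = (\<Sum>A\<in>Pow S. split_weight q t (card A) (card (S - A))
    * q ^ cross_inv A (S - A) * aid_des_sum q t A * aid_des_sum q t (S - A))"
proof -
  have "M \<notin> S" using M by blast
  let ?w = "\<lambda>xs. q ^ aid xs * t ^ des xs"
  have "aid_des_sum q t (insert M S)
      = (\<Sum>(A, \<alpha>, \<beta>)\<in>(SIGMA A:Pow S. permutations_of_set A \<times> permutations_of_set (S - A)). ?w (\<alpha> @ M # \<beta>))"
    unfolding aid_des_sum_def
    by (subst sum.reindex_bij_betw[OF bij_betw_split_max[OF \<open>M \<notin> S\<close>], symmetric])
      (auto intro!: sum.cong)
  also have "\<dots> = (\<Sum>A\<in>Pow S. \<Sum>(\<alpha>, \<beta>)\<in>permutations_of_set A \<times> permutations_of_set (S - A). ?w (\<alpha> @ M # \<beta>))"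
    by (subst sum.Sigma[symmetric]) (use fin in auto)
  also have "\<dots> = (\<Sum>A\<in>Pow S. split_weight q t (card A) (card (S - A))
    * q ^ cross_inv A (S - A) * aid_des_sum q t A * aid_des_sum q t (S - A))"
  proof (rule sum.cong)
    fix A assume "A \<in> Pow S"
    let ?c = "split_weight q t (card A) (card (S - A)) * q ^ cross_inv A (S - A)"
    have "?w (\<alpha> @ M # \<beta>) = ?c * ?w \<alpha> * ?w \<beta>"
      if \<alpha>: "\<alpha> \<in> permutations_of_set A" and \<beta>: "\<beta> \<in> permutations_of_set (S - A)" for \<alpha> \<beta>
    proof -
      have set: "set \<alpha> = A" "set \<beta> = S - A" "distinct \<alpha>" "distinct \<beta>"
        using \<alpha> \<beta> by (auto dest: permutations_of_setD)
      then have len: "length \<alpha> = card A" "length \<beta> = card (S - A)"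
        using distinct_card by metis+
      have less: "x < M" if "x \<in> set \<alpha> \<union> set \<beta>" for x
        using that set \<open>A \<in> Pow S\<close> M by auto
      have dist: "distinct (\<alpha> @ M # \<beta>)"
        using set less by auto
      have nil: "\<alpha> = [] \<longleftrightarrow> card A = 0" "\<beta> = [] \<longleftrightarrow> card (S - A) = 0"
        using len by auto
      show ?thesis
        using des_max_split[of \<alpha> \<beta> M, OF less] ai_max_split[of \<alpha> \<beta> M, OF less dist]
        unfolding aid_def split_weight_def set(1,2) len nil
        by (auto simp: power_add algebra_simps)
    qed
    then have "(\<Sum>(\<alpha>, \<beta>)\<in>permutations_of_set A \<times> permutations_of_set (S - A). ?w (\<alpha> @ M # \<beta>))
        = (\<Sum>\<alpha>\<in>permutations_of_set A. \<Sum>\<beta>\<in>permutations_of_set (S - A). ?c * ?w \<alpha> * ?w \<beta>)"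
      unfolding sum.cartesian_product by (intro sum.cong) auto
    also have "\<dots> = ?c * (aid_des_sum q t A * aid_des_sum q t (S - A))"
      unfolding aid_des_sum_def sum_product by (simp only: sum_distrib_left mult.assoc)
    finally show "(\<Sum>(\<alpha>, \<beta>)\<in>permutations_of_set A \<times> permutations_of_set (S - A). ?w (\<alpha> @ M # \<beta>))
        = ?c * aid_des_sum q t A * aid_des_sum q t (S - A)"
      by (simp add: mult.assoc)
  qed simp
  finally show ?thesis .
qed

text \<open>The recursion determines \<open>A\<close> from \<open>A 0\<close>, so it suffices that
  removing the maximum reproduces it. The sets of \<open>k\<close> letters before the maximum
  together contribute \<open>qbinom q n k\<close> by \<open>sum_cross_inv\<close>.\<close>

lemma aid_des_sum_unique:
  assumes A0: "A 0 = 1"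
    and A_Suc: "\<And>n. A (Suc n) = A n + q * t * qconv q (\<lambda>k. A k - qunit k) (\<lambda>k. q ^ k * A k) n"
    and "finite S"
  shows "aid_des_sum q t S = A (card S)"
  using \<open>finite S\<close>
proof (induction "card S" arbitrary: S rule: less_induct)
  case less
  show ?case
  proof (cases "S = {}")
    case True
    have "Des [] = {}" "{(i, j). admissible_inv [] i j} = {}"
      by (auto simp: Des_def admissible_inv_def)
    then show ?thesis using True A0 by (simp add: aid_des_sum_def aid_def ai_def des_def)
  next
    case False
    define M where "M = Max S"
    define S' where "S' = S - {M}"
    define n where "n = card S'"
    have "M \<in> S" using False less.prems by (simp add: M_def)
    then have S: "S = insert M S'" "M \<notin> S'" "finite S'"
      using less.prems by (auto simp: S'_def)
    have M_less: "x < M" if "x \<in> S'" for x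
      using that less.prems by (auto simp: M_def S'_def less_le)
    have card: "card S = Suc n" using S by (simp add: n_def)
    have IH: "aid_des_sum q t B = A (card B)" if "B \<subseteq> S'" for B
      using that S card card_mono[OF S(3) that]
      by (intro less.hyps) (auto simp: n_def dest: finite_subset)
    have "aid_des_sum q t S = (\<Sum>B\<in>Pow S'. split_weight q t (card B) (card (S' - B))
        * q ^ cross_inv B (S' - B) * aid_des_sum q t B * aid_des_sum q t (S' - B))"
      unfolding S(1) by (rule aid_des_sum_insert_max) (use S M_less in auto)
    also have "\<dots> = (\<Sum>B\<in>Pow S'. split_weight q t (card B) (n - card B)
        * q ^ cross_inv B (S' - B) * A (card B) * A (n - card B))"
    proof (rule sum.cong)
      fix B assume "B \<in> Pow S'"
      then have "B \<subseteq> S'" "card (S' - B) = n - card B"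
        using S(3) finite_subset[of B S'] by (auto simp: n_def card_Diff_subset)
      then show "split_weight q t (card B) (card (S' - B))
            * q ^ cross_inv B (S' - B) * aid_des_sum q t B * aid_des_sum q t (S' - B)
          = split_weight q t (card B) (n - card B)
            * q ^ cross_inv B (S' - B) * A (card B) * A (n - card B)"
        using IH[of B] IH[of "S' - B"] by simp
    qed simp
    also have "\<dots> = (\<Sum>k\<le>n. \<Sum>B | B \<in> Pow S' \<and> card B = k. split_weight q t (card B) (n - card B)
        * q ^ cross_inv B (S' - B) * A (card B) * A (n - card B))"
      by (rule sum.group[symmetric]) (use S(3) in \<open>auto simp: n_def intro: card_mono\<close>)
    also have "\<dots> = (\<Sum>k\<le>n. split_weight q t k (n - k) * qbinom q n k * A k * A (n - k))"
    proof (rule sum.cong)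
      fix k
      have "(\<Sum>B | B \<in> Pow S' \<and> card B = k. split_weight q t (card B) (n - card B)
            * q ^ cross_inv B (S' - B) * A (card B) * A (n - card B))
          = (\<Sum>B | B \<subseteq> S' \<and> card B = k. (split_weight q t k (n - k) * A k * A (n - k))
            * q ^ cross_inv B (S' - B))"
        by (rule sum.cong) (auto simp: mult_ac)
      also have "\<dots> = (split_weight q t k (n - k) * A k * A (n - k)) * qbinom q n k"
        unfolding sum_distrib_left[symmetric] n_def by (simp only: sum_cross_inv[OF S(3)])
      finally show "(\<Sum>B | B \<in> Pow S' \<and> card B = k. split_weight q t (card B) (n - card B)
            * q ^ cross_inv B (S' - B) * A (card B) * A (n - card B))
          = split_weight q t k (n - k) * qbinom q n k * A k * A (n - k)"
        by (simp add: mult_ac)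
    qed simp
    \<comment> \<open>The summand \<open>k = n\<close>, with nothing after the maximum, is the free
      term \<open>A n\<close>. The summand \<open>k = 0\<close>, equal to
      \<open>q * t * A n\<close>, matches the summand \<open>k = n\<close> of the convolution, whose
      own summand \<open>k = 0\<close> vanishes as \<open>A 0 = 1\<close>. For \<open>n = 0\<close>
      the two ends coincide, hence the separate case.\<close>
    also have "\<dots> = A (Suc n)"
    proof (cases n)
      case 0
      then show ?thesis using A0 A_Suc[of 0] by (simp add: split_weight_def)
    next
      case n: (Suc m)
      let ?mid = "\<Sum>k=1..m. qbinom q n k * A k * (q ^ (n - k) * A (n - k))"
      have split: "(\<Sum>k\<le>n. f k) = f 0 + (\<Sum>k=1..m. f k) + f n" for f :: "nat \<Rightarrow> 'a"
      proof -
        have "{..n} = insert 0 (insert n {1..m})" using n by auto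
        then show ?thesis using n by (simp add: algebra_simps)
      qed
      have "(\<Sum>k\<le>n. split_weight q t k (n - k) * qbinom q n k * A k * A (n - k))
          = q * t * A n + (\<Sum>k=1..m. split_weight q t k (n - k) * qbinom q n k * A k * A (n - k)) + A n"
        unfolding split using A0 n by (simp add: split_weight_def del: qbinom.simps(3))
      also have "(\<Sum>k=1..m. split_weight q t k (n - k) * qbinom q n k * A k * A (n - k)) = q * t * ?mid"
        unfolding sum_distrib_left
        by (rule sum.cong) (use n in \<open>auto simp: split_weight_def mult_ac\<close>)
      also have "q * t * A n + q * t * ?mid + A n
          = A n + q * t * qconv q (\<lambda>k. A k - qunit k) (\<lambda>k. q ^ k * A k) n"
      proof -
        have "qconv q (\<lambda>k. A k - qunit k) (\<lambda>k. q ^ k * A k) n = ?mid + A n"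
          unfolding qconv_def split using A0 n by (simp del: qbinom.simps(3))
        then show ?thesis by (simp add: algebra_simps)
      qed
      finally show ?thesis by (simp only: A_Suc)
    qed
    finally show ?thesis by (simp add: card)
  qed
qed

section \<open>The identity over integral domains and its transfer to commutative rings\<close>

lemma sum_aid_des_eq_sum_maj_exc_idom:
  fixes q t :: "'a::idom"
  assumes "q * t \<noteq> 1"
  shows "(\<Sum>s\<in>perms n. q ^ aid s * t ^ des s) = (\<Sum>s\<in>perms n. q ^ maj s * t ^ exc s)"
proof -
  have "aid_des_sum q t {1..n} = maj_exc_sum q t (card {1..n})"
    by (rule aid_des_sum_unique) (use assms in \<open>simp_all add: maj_exc_sum_0 maj_exc_sum_Suc\<close>)
  then show ?thesis
    unfolding sum_perms_maj_exc by (simp add: aid_des_sum_def perms_eq)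
qed

text \<open>With \<open>q\<close> as inner and \<open>t\<close> as outer variable, coefficients
  count how often a pair of exponents occurs, so equal polynomials yield equal multisets of
  pairs.\<close>

lemma coeff_sum_monom_monom:
  fixes f g :: "'b \<Rightarrow> nat"
  assumes "finite S"
  shows "coeff (coeff (\<Sum>s\<in>S. [:[:0, 1:]:] ^ f s * [:0, 1:] ^ g s) b) a
    = (of_nat (count (image_mset (\<lambda>s. (f s, g s)) (mset_set S)) (a, b)) :: int)"
proof -
  have "[:[:0, 1:]:] ^ i * [:0, 1:] ^ j = monom (monom 1 i :: int poly) j" for i j
    by (simp add: monom_altdef poly_const_pow)
  note monom = this
  show ?thesis
    using assms by (induction S rule: finite_induct) (auto simp: monom)
qed

text \<open>The cancellation of \<open>1 - q t\<close> requires an integral domain, so the identity is first proved in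
  \<open>\<int>[q][t]\<close>, where it says that the two pairs of statistics are equidistributed.\<close>

theorem theorem6p1:
  fixes q t :: "'a :: comm_ring_1" and n :: nat
  shows "(\<Sum>s\<in>perms n. q ^ aid s * t ^ des s) = (\<Sum>s\<in>perms n. q ^ maj s * t ^ exc s)"
proof -
  let ?M = "\<lambda>f g. image_mset (\<lambda>s. (f s, g s)) (mset_set (perms n))"
  have fin: "finite (perms n)" by (simp add: perms_eq)
  let ?q = "[:[:0, 1:]:] :: int poly poly" and ?t = "[:0, 1:] :: int poly poly"
  have "?q * ?t \<noteq> 1" by (simp add: one_pCons)
  then have "(\<Sum>s\<in>perms n. ?q ^ aid s * ?t ^ des s) = (\<Sum>s\<in>perms n. ?q ^ maj s * ?t ^ exc s)"
    by (rule sum_aid_des_eq_sum_maj_exc_idom)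
  then have "count (?M aid des) (a, b) = count (?M maj exc) (a, b)" for a b
    using coeff_sum_monom_monom[OF fin, of aid des b a] coeff_sum_monom_monom[OF fin, of maj exc b a]
    by simp
  then have "?M aid des = ?M maj exc" by (intro multiset_eqI) auto
  \<comment> \<open>Equality of the joint distributions no longer mentions a ring, so
    \<open>q\<close> and \<open>t\<close> may be taken from any commutative ring.\<close>
  then have "image_mset (\<lambda>(a, b). q ^ a * t ^ b) (?M aid des)
      = image_mset (\<lambda>(a, b). q ^ a * t ^ b) (?M maj exc)" by simp
  then show ?thesis
    by (simp add: sum_unfold_sum_mset image_mset.compositionality o_def)
qed

end
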